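(* Let $X=(X_t)_{t\ge0}$ be a rich Feller process on $\mathbb{R}^d$ with symbol $p(x,\xi)$ and characteristic triplet $(b(x),0,\nu(x,dy))$. If $X_t$ is positive upper orthant dependent (PUOD) for each $t\ge0$ (with respect to $\mathbb{P}^x$, for every $x\in\mathbb{R}^d$), then $$\nu\bigl(x,(\mathbb{R}_+^d\cup\mathbb{R}_-^d)^c\bigr)=0\qquad\text{for all } x\in\mathbb{R}^d.$$
   Context: Let $X=(X_t)_{t\ge0}$ be a time-homogeneous Markov process with state space $\mathbb{R}^d$, under probability measures $(\mathbb{P}^x)_{x\in\mathbb{R}^d}$ with $\mathbb{P}^x(X_0=x)=1$, and semigroup $T_tf(x)=\mathbb{E}^xf(X_t)$ for bounded measurable $f$. It is a Feller process if $T_t$ maps $C_0(\mathbb{R}^d)$ (continuous functions vanishing at infinity) to itself and $\lim_{t\to0}\|T_tu-u\|_\infty=0$ for all $u\in C_0(\mathbb{R}^d)$. Its generator is $\mathcal{A}f=\lim_{t\searrow0}(T_tf-f)/t$ (uniform limit), with domain $\mathcal{D}(\mathcal{A})$ the set of $f\in C_0(\mathbb{R}^d)$ for which the limit exists uniformly. The process is rich if $C_c^\infty(\mathbb{R}^d)\subset\mathcal{D}(\mathcal{A})$. For a rich Feller process (with no killing, the paper's standing assumption) one has, for $f\in C_c^\infty(\mathbb{R}^d)$, $\mathcal{A}f(x)=(2\pi)^{-d/2}\int_{\mathbb{R}^d}e^{i\xi\cdot x}p(x,\xi)\hat f(\xi)\,d\xi$, where the symbol $p$ has the form $$p(x,\xi)=ib(x)\cdot\xi-\tfrac12\xi\cdot\Sigma(x)\xi+\int_{\mathbb{R}^d\setminus\{0\}}\bigl(e^{i\xi\cdot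 y}-1-i\xi\cdot y\,\chi(y)\bigr)\nu(x,dy),\qquad \chi(y)=\mathbf{1}_{(0,1)}(|y|).$$ The characteristic triplet is $(b(x),\Sigma(x),\nu(x,dy))$: $b(x)\in\mathbb{R}^d$, $\Sigma(x)$ is symmetric positive semidefinite, and $\nu(x,\cdot)$ is a measure on $\mathbb{R}^d\setminus\{0\}$ with $\int(1\wedge|y|^2)\nu(x,dy)<\infty$. The triplet $(b(x),0,\nu(x,dy))$ means $\Sigma\equiv0$. A random vector $Y=(Y_1,\dots,Y_d)$ is positive upper orthant dependent (PUOD) if $\mathbb{P}(Y_1>t_1,\dots,Y_d>t_d)\ge\prod_{i=1}^d\mathbb{P}(Y_i>t_i)$ for all $t_1,\dots,t_d\in\mathbb{R}$. $\mathbb{R}_+^d=[0,\infty)^d$, $\mathbb{R}_-^d=(-\infty,0]^d$. *)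

theory Defs
  imports "HOL-Analysis.Analysis" "HOL-Probability.Probability"
begin

text \<open>
  A process is a family of measures \<open>P x\<close> (the law under which the process starts in \<open>x\<close>) on a
  common measurable space, together with random variables \<open>X t\<close>, of which only the times
  \<open>t \<ge> 0\<close> matter.
\<close>

definition natural_filtration ::
    "(real ^ 'n \<Rightarrow> 'w measure) \<Rightarrow> (real \<Rightarrow> 'w \<Rightarrow> real ^ 'n) \<Rightarrow> real ^ 'n \<Rightarrow> real \<Rightarrow> 'w measure"
  where "natural_filtration P X x t =
    sigma (space (P x)) {X s -` B \<inter> space (P x) | s B. 0 \<le> s \<and> s \<le> t \<and> B \<in> sets borel}"

definition markov_process ::
    "(real ^ 'n \<Rightarrow> 'w measure) \<Rightarrow> (real \<Rightarrow> 'w \<Rightarrow> real ^ 'n) \<Rightarrow> bool"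
  where "markov_process P X \<longleftrightarrow>
    (\<forall>x. prob_space (P x)) \<and>
    (\<forall>x y. sets (P x) = sets (P y)) \<and>
    (\<forall>x. \<forall>t\<ge>0. X t \<in> measurable (P x) borel) \<and>
    (\<forall>x. AE \<omega> in P x. X 0 \<omega> = x) \<and>
    (\<forall>t\<ge>0. \<forall>B\<in>sets borel. (\<lambda>x. measure (P x) {\<omega> \<in> space (P x). X t \<omega> \<in> B}) \<in> borel_measurable borel) \<and>
    (\<forall>x. \<forall>s\<ge>0. \<forall>t\<ge>0. \<forall>B\<in>sets borel. AE \<omega> in P x.
       real_cond_exp (P x) (natural_filtration P X x s) (\<lambda>\<omega>'. indicator B (X (s + t) \<omega>')) \<omega> =
       measure (P (X s \<omega>)) {\<omega>' \<in> space (P (X s \<omega>)). X t \<omega>' \<in> B})"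

definition transition_semigroup ::
    "(real ^ 'n \<Rightarrow> 'w measure) \<Rightarrow> (real \<Rightarrow> 'w \<Rightarrow> real ^ 'n) \<Rightarrow> real \<Rightarrow>
     (real ^ 'n \<Rightarrow> real) \<Rightarrow> real ^ 'n \<Rightarrow> real"
  where "transition_semigroup P X t f x = (\<integral>\<omega>. f (X t \<omega>) \<partial>P x)"

definition C0 :: "(real ^ 'n \<Rightarrow> real) set"
  where "C0 = {f. continuous_on UNIV f \<and> (f \<longlongrightarrow> 0) at_infinity}"

definition feller_process ::
    "(real ^ 'n \<Rightarrow> 'w measure) \<Rightarrow> (real \<Rightarrow> 'w \<Rightarrow> real ^ 'n) \<Rightarrow> bool"
  where "feller_process P X \<longleftrightarrow>
    markov_process P X \<and>
    (\<forall>t\<ge>0. \<forall>f\<in>C0. transition_semigroup P X t f \<in> C0) \<and>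
    (\<forall>f\<in>C0. uniform_limit UNIV (\<lambda>t. transition_semigroup P X t f) f (at_right 0))"

definition has_generator_value ::
    "(real ^ 'n \<Rightarrow> 'w measure) \<Rightarrow> (real \<Rightarrow> 'w \<Rightarrow> real ^ 'n) \<Rightarrow>
     (real ^ 'n \<Rightarrow> real) \<Rightarrow> (real ^ 'n \<Rightarrow> real) \<Rightarrow> bool"
  where "has_generator_value P X f g \<longleftrightarrow>
    uniform_limit UNIV (\<lambda>t x. (transition_semigroup P X t f x - f x) / t) g (at_right 0)"

definition generator_domain ::
    "(real ^ 'n \<Rightarrow> 'w measure) \<Rightarrow> (real \<Rightarrow> 'w \<Rightarrow> real ^ 'n) \<Rightarrow> (real ^ 'n \<Rightarrow> real) set"
  where "generator_domain P X = {f \<in> C0. \<exists>g. has_generator_value P X f g}"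

definition generator ::
    "(real ^ 'n \<Rightarrow> 'w measure) \<Rightarrow> (real \<Rightarrow> 'w \<Rightarrow> real ^ 'n) \<Rightarrow>
     (real ^ 'n \<Rightarrow> real) \<Rightarrow> real ^ 'n \<Rightarrow> real"
  where "generator P X f = (THE g. has_generator_value P X f g)"

lemma generator_eqI:
  assumes "has_generator_value P X f g"
  shows "generator P X f = g"
  unfolding generator_def
proof (rule the_equality)
  fix h assume "has_generator_value P X f h"
  show "h = g"
  proof
    fix x
    show "h x = g x"
    proof (rule tendsto_unique[OF trivial_limit_at_right_real])
      show "((\<lambda>t. (transition_semigroup P X t f x - f x) / t) \<longlongrightarrow> h x) (at_right 0)"
        using \<open>has_generator_value P X f h\<close> unfolding has_generator_value_def
        by (rule tendsto_uniform_limitI) simp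
      show "((\<lambda>t. (transition_semigroup P X t f x - f x) / t) \<longlongrightarrow> g x) (at_right 0)"
        using assms unfolding has_generator_value_def by (rule tendsto_uniform_limitI) simp
    qed
  qed
qed (fact assms)

text \<open>\<open>Ck k f\<close>: all partial derivatives of \<open>f\<close> up to order \<open>k\<close> exist and are continuous.\<close>

primrec Ck :: "nat \<Rightarrow> (real ^ 'n \<Rightarrow> real) \<Rightarrow> bool"
  where
    "Ck 0 f \<longleftrightarrow> continuous_on UNIV f"
  | "Ck (Suc k) f \<longleftrightarrow> (\<forall>x. f differentiable at x) \<and>
       (\<forall>i. Ck k (\<lambda>x. frechet_derivative f (at x) (axis i 1)))"

definition Cc_infinity :: "(real ^ 'n \<Rightarrow> real) set"
  where "Cc_infinity = {f. (\<forall>k. Ck k f) \<and> compact (closure {x. f x \<noteq> 0})}"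

definition rich_feller_process ::
    "(real ^ 'n \<Rightarrow> 'w measure) \<Rightarrow> (real \<Rightarrow> 'w \<Rightarrow> real ^ 'n) \<Rightarrow> bool"
  where "rich_feller_process P X \<longleftrightarrow>
    feller_process P X \<and> Cc_infinity \<subseteq> generator_domain P X"

definition fourier :: "(real ^ 'n \<Rightarrow> real) \<Rightarrow> real ^ 'n \<Rightarrow> complex"
  where "fourier f \<xi> = of_real ((2 * pi) powr (- (real CARD('n) / 2))) *
    (\<integral>x. exp (- \<i> * of_real (\<xi> \<bullet> x)) * of_real (f x) \<partial>lborel)"

definition has_symbol ::
    "(real ^ 'n \<Rightarrow> 'w measure) \<Rightarrow> (real \<Rightarrow> 'w \<Rightarrow> real ^ 'n) \<Rightarrow>
     (real ^ 'n \<Rightarrow> real ^ 'n \<Rightarrow> complex) \<Rightarrow> bool"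
  where "has_symbol P X p \<longleftrightarrow> (\<forall>f\<in>Cc_infinity. \<forall>x.
    of_real (generator P X f x) = of_real ((2 * pi) powr (- (real CARD('n) / 2))) *
      (\<integral>\<xi>. exp (\<i> * of_real (\<xi> \<bullet> x)) * p x \<xi> * fourier f \<xi> \<partial>lborel))"

definition cutoff :: "real ^ 'n \<Rightarrow> real"
  where "cutoff y = indicator {0<..<1} (norm y)"

definition levy_measure :: "(real ^ 'n) measure \<Rightarrow> bool"
  where "levy_measure \<nu> \<longleftrightarrow>
    sets \<nu> = sets (restrict_space borel (- {0})) \<and>
    (\<integral>\<^sup>+ y. ennreal (min 1 ((norm y)\<^sup>2)) \<partial>\<nu>) < \<infinity>"

definition levy_khintchine ::
    "real ^ 'n \<Rightarrow> real ^ 'n ^ 'n \<Rightarrow> (real ^ 'n) measure \<Rightarrow> real ^ 'n \<Rightarrow> complex"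
  where "levy_khintchine b S \<nu> \<xi> =
    \<i> * of_real (b \<bullet> \<xi>) - of_real (\<xi> \<bullet> (S *v \<xi>)) / 2 +
    (\<integral>y. (exp (\<i> * of_real (\<xi> \<bullet> y)) - 1 - \<i> * of_real (\<xi> \<bullet> y) * of_real (cutoff y)) \<partial>\<nu>)"

definition characteristic_triplet ::
    "(real ^ 'n \<Rightarrow> real ^ 'n \<Rightarrow> complex) \<Rightarrow> (real ^ 'n \<Rightarrow> real ^ 'n) \<Rightarrow>
     (real ^ 'n \<Rightarrow> real ^ 'n ^ 'n) \<Rightarrow> (real ^ 'n \<Rightarrow> (real ^ 'n) measure) \<Rightarrow> bool"
  where "characteristic_triplet p b S \<nu> \<longleftrightarrow> (\<forall>x.
    transpose (S x) = S x \<and> (\<forall>\<xi>. 0 \<le> \<xi> \<bullet> (S x *v \<xi>)) \<and>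
    levy_measure (\<nu> x) \<and>
    (\<forall>\<xi>. p x \<xi> = levy_khintchine (b x) (S x) (\<nu> x) \<xi>))"

definition PUOD :: "'w measure \<Rightarrow> ('w \<Rightarrow> real ^ 'n) \<Rightarrow> bool"
  where "PUOD M Y \<longleftrightarrow> (\<forall>t :: real ^ 'n.
    measure M {\<omega> \<in> space M. \<forall>i. Y \<omega> $ i > t $ i} \<ge>
    (\<Prod>i\<in>UNIV. measure M {\<omega> \<in> space M. Y \<omega> $ i > t $ i}))"

definition pos_orthant :: "(real ^ 'n) set"
  where "pos_orthant = {y. \<forall>i. 0 \<le> y $ i}"

definition neg_orthant :: "(real ^ 'n) set"
  where "neg_orthant = {y. \<forall>i. y $ i \<le> 0}"

lemma orthants_compl_measurable:
  assumes "levy_measure \<nu>"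
  shows "- (pos_orthant \<union> neg_orthant) \<in> sets \<nu>"
proof -
  have "closed (pos_orthant :: (real ^ 'n) set)" "closed (neg_orthant :: (real ^ 'n) set)"
    unfolding pos_orthant_def neg_orthant_def
    by (intro closed_Collect_all closed_Collect_le continuous_intros)+
  then have "- (pos_orthant \<union> neg_orthant :: (real ^ 'n) set) \<in> sets borel"
    by (intro borel_open open_Compl closed_Un)
  moreover have "- (pos_orthant \<union> neg_orthant :: (real ^ 'n) set) \<subseteq> - {0}"
    by (auto simp: pos_orthant_def)
  ultimately show ?thesis
    using assms unfolding levy_measure_def by (auto simp: sets_restrict_space_iff)
qed

end

theory Submission
  imports Defs
begin

text \<open>
  The idea: positive upper orthant dependence makes it very unlikely that within a short time \<open>t\<close>
  one coordinate makes a jump up while another makes a jump down, whereas a Levy measure charging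
  that event would make it happen with probability of order \<open>t\<close>.

  Fix the starting point \<open>x\<close>, a threshold \<open>r > 0\<close>, and let \<open>\<epsilon>(t)\<close> be the probability that some
  coordinate of \<open>X\<^sub>t\<close> is at distance at least \<open>r\<close> from that of \<open>x\<close>. Applying the generator to a bump
  centred at \<open>x\<close> gives \<open>\<epsilon>(t) = O(t)\<close> (\<open>eventually_exit_prob_le\<close>). Positive upper orthant dependence at
  the point with coordinates \<open>x\<^sub>i + r\<close> and \<open>x\<^sub>k - r\<close> for \<open>k \<noteq> i\<close> says that the event
  that \<open>X\<^sub>t\<^sub>,\<^sub>i > x\<^sub>i + r\<close> while some other coordinate has dropped by at least \<open>r\<close> is at most as
  likely as it would be for independent coordinates. Hence it has probability at most
  \<open>d \<epsilon>(t)\<^sup>2 = O(t\<^sup>2)\<close> (\<open>prob_gt_not_all_gt_le\<close>).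

  Now let \<open>f \<ge> 0\<close> be a smooth bump that is positive exactly on an open box inside
  \<open>{y. y\<^sub>i > x\<^sub>i + r, y\<^sub>j < x\<^sub>j - r}\<close>. Then \<open>f(x) = 0\<close> and \<open>T\<^sub>t f(x) = O(t\<^sup>2)\<close>, so the
  generator satisfies \<open>A f(x) \<le> 0\<close> (\<open>PUOD_generator_bump_nonpos\<close>). As \<open>f\<close> vanishes near \<open>x\<close>, the
  integro-differential form of the generator reduces to \<open>A f(x) = \<integral> f(x + y) \<nu>(x, dy)\<close>; so this integral
  of a nonnegative function is zero and the translated box is \<open>\<nu>(x, \<cdot>)\<close>-null. Countably many such boxes
  cover the complement of the two orthants.

  What remains is to pass from the Fourier representation of the generator to the
  integro-differential one (\<open>generator_tensor\<close>). Only bumps on boxes are needed, and these can be taken to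
  be products of one-dimensional bumps. Their Fourier transforms are products too, so that decay and
  Fourier inversion are needed in one dimension only, and Fubini's theorem does the rest.
\<close>

section \<open>Smooth compactly supported functions on the line\<close>

text \<open>The recursion goes through \<^const>\<open>deriv\<close>, as that of \<^const>\<open>Ck\<close> goes through partial derivatives,
  so that the two notions can be compared by induction on \<open>k\<close>.\<close>
primrec cont_diff :: "nat \<Rightarrow> (real \<Rightarrow> real) \<Rightarrow> bool" where
  "cont_diff 0 f \<longleftrightarrow> continuous_on UNIV f"
| "cont_diff (Suc k) f \<longleftrightarrow> (\<forall>s. (f has_real_derivative deriv f s) (at s)) \<and> cont_diff k (deriv f)"

lemma cont_diff_SucI:
  assumes "\<And>s. (f has_real_derivative f' s) (at s)" and "cont_diff k f'"
  shows "cont_diff (Suc k) f"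
proof -
  have "deriv f = f'" using assms(1) by (intro ext DERIV_imp_deriv)
  with assms show ?thesis by simp
qed

lemma cont_diff_decrease: "cont_diff (Suc k) f \<Longrightarrow> cont_diff k f"
proof (induction k arbitrary: f)
  case 0 then show ?case
    by (auto intro!: continuous_at_imp_continuous_on DERIV_isCont)
qed auto

lemma cont_diff_add:
  "cont_diff k f \<Longrightarrow> cont_diff k g \<Longrightarrow> cont_diff k (\<lambda>s. f s + g s)"
proof (induction k arbitrary: f g)
  case 0 then show ?case by (auto intro: continuous_intros)
next
  case (Suc k)
  then show ?case
    by (intro cont_diff_SucI[where f' = "\<lambda>s. deriv f s + deriv g s"]) (auto intro!: derivative_eq_intros)
qed

lemma cont_diff_mult:
  "cont_diff k f \<Longrightarrow> cont_diff k g \<Longrightarrow> cont_diff k (\<lambda>s. f s * g s)"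
proof (induction k arbitrary: f g)
  case 0 then show ?case by (auto intro: continuous_intros)
next
  case (Suc k)
  have "cont_diff k (\<lambda>s. deriv f s * g s + f s * deriv g s)"
    using Suc.prems by (intro cont_diff_add Suc.IH) (auto intro: cont_diff_decrease)
  with Suc.prems show ?case
    by (intro cont_diff_SucI[where f' = "\<lambda>s. deriv f s * g s + f s * deriv g s"])
       (auto intro!: derivative_eq_intros)
qed

text \<open>This family contains the function \<open>exp(-1/s)\<close>, extended by zero to \<open>s \<le> 0\<close>, and is
  closed under differentiation. The polynomial factor records how derivatives act, which makes
  smoothness an easy induction.\<close>
definition flat_exp :: "real poly \<Rightarrow> real \<Rightarrow> real" where
  "flat_exp p s = (if s > 0 then poly p (1 / s) * exp (- 1 / s) else 0)"

lemma tendsto_poly_exp_at_right_0: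
  "((\<lambda>h. poly p (1 / h) * exp (- 1 / h)) \<longlongrightarrow> (0::real)) (at_right 0)"
proof -
  have "((\<lambda>u. poly p u * exp (- u)) \<longlongrightarrow> (0::real)) at_top"
  proof -
    have "((\<lambda>u. \<Sum>i\<le>degree p. coeff p i * (u ^ i / exp u)) \<longlongrightarrow> (\<Sum>i\<le>degree p. coeff p i * 0)) at_top"
      by (intro tendsto_sum tendsto_mult tendsto_const tendsto_power_div_exp_0)
    then show ?thesis
      by (simp add: poly_altdef sum_divide_distrib exp_minus divide_inverse sum_distrib_right mult.assoc)
  qed
  from filterlim_compose[OF this filterlim_inverse_at_top_right]
  show ?thesis by (simp add: inverse_eq_divide)
qed

text \<open>For \<open>s > 0\<close> this is the chain rule: differentiating \<open>p(1/s) exp(-1/s)\<close> produces the factor \<open>1/s\<^sup>2\<close>,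
  that is, the polynomial \<open>[:0, 0, 1:]\<close> in \<open>1/s\<close>. At \<open>0\<close> the difference quotient is again of the
  form \<open>q(1/s) exp(-1/s)\<close>, which is beaten by the exponential.\<close>
lemma flat_exp_deriv:
  "(flat_exp p has_real_derivative flat_exp ([:0, 0, 1:] * (p - pderiv p)) s) (at s)"
proof -
  consider "s > 0" | "s < 0" | "s = 0" by linarith
  then show ?thesis
  proof cases
    case 1
    have "((\<lambda>s. poly p (1 / s) * exp (- 1 / s)) has_real_derivative
        flat_exp ([:0, 0, 1:] * (p - pderiv p)) s) (at s)"
      using 1 by (auto intro!: derivative_eq_intros simp: flat_exp_def field_simps power2_eq_square)
    moreover have "\<forall>\<^sub>F x in nhds s. flat_exp p x = poly p (1 / x) * exp (- 1 / x)"
      using eventually_nhds_in_open[of "{0<..}" s] 1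
      by (auto elim!: eventually_mono simp: flat_exp_def)
    ultimately show ?thesis by (subst DERIV_cong_ev[OF refl _ refl])
  next
    case 2
    have "\<forall>\<^sub>F x in nhds s. flat_exp p x = 0"
      using eventually_nhds_in_open[of "{..<0}" s] 2
      by (auto elim!: eventually_mono simp: flat_exp_def)
    then show ?thesis using 2 by (subst DERIV_cong_ev[OF refl _ refl]) (auto simp: flat_exp_def)
  next
    case 3
    have "((\<lambda>y. flat_exp p y / y) \<longlongrightarrow> 0) (at_right 0)"
      using tendsto_poly_exp_at_right_0[of "pCons 0 p"]
      by (rule Lim_transform_eventually)
         (auto simp: flat_exp_def eventually_at_filter intro!: always_eventually)
    moreover have "((\<lambda>y. flat_exp p y / y) \<longlongrightarrow> 0) (at_left 0)"
      by (rule Lim_transform_eventually[of "\<lambda>_. 0"])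
         (auto simp: flat_exp_def eventually_at_filter intro!: always_eventually)
    ultimately have "((\<lambda>y. flat_exp p y / y) \<longlongrightarrow> 0) (at 0)"
      by (simp add: filterlim_at_split)
    with 3 show ?thesis by (simp add: has_field_derivative_iff flat_exp_def)
  qed
qed

lemma cont_diff_flat_exp_affine: "cont_diff k (\<lambda>s. flat_exp p (a + c * s))"
proof (induction k arbitrary: p)
  case 0
  show ?case by (auto intro!: continuous_at_imp_continuous_on DERIV_isCont[OF DERIV_chain'[OF _ flat_exp_deriv]]
        derivative_eq_intros)
next
  case (Suc k)
  have *: "flat_exp q s * c = flat_exp (smult c q) s" for q s by (simp add: flat_exp_def)
  show ?case
  proof (rule cont_diff_SucI)
    show "((\<lambda>s. flat_exp p (a + c * s)) has_real_derivative
        flat_exp (smult c ([:0, 0, 1:] * (p - pderiv p))) (a + c * s)) (at s)" for s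
      unfolding *[symmetric]
      by (rule DERIV_cong[OF DERIV_chain'[OF _ flat_exp_deriv, where f = "\<lambda>s. a + c * s" and D = c]])
         (auto intro!: derivative_eq_intros)
  qed (rule Suc.IH)
qed

definition bump :: "real \<Rightarrow> real \<Rightarrow> real \<Rightarrow> real" where
  "bump l u s = flat_exp 1 (s - l) * flat_exp 1 (u - s)"

definition test_function :: "(real \<Rightarrow> real) \<Rightarrow> bool" where
  "test_function f \<longleftrightarrow> (\<forall>k. cont_diff k f) \<and> (\<exists>l u. \<forall>s. s \<notin> {l..u} \<longrightarrow> f s = 0)"

lemma bump_nonneg: "bump l u s \<ge> 0"
  by (auto simp: bump_def flat_exp_def)

lemma bump_eq_0_iff: "bump l u s = 0 \<longleftrightarrow> \<not> (l < s \<and> s < u)"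
  by (auto simp: bump_def flat_exp_def)

lemma bump_le_1: "bump l u s \<le> 1"
  by (auto simp: bump_def flat_exp_def intro!: mult_le_one)

text \<open>The product of the two exponentials is \<open>exp(-(1/a + 1/b))\<close>, where \<open>a\<close> and \<open>b\<close> are the distances to
  the endpoints and \<open>a + b\<close> is fixed; \<open>1/a + 1/b\<close> is least for \<open>a = b\<close>. Thanks to this a bump itself
  can detect that the process has left a box, and no smooth cutoff with a plateau has to be built.\<close>
lemma bump_le_centre:
  assumes "r > 0"
  shows "bump (x - r) (x + r) s \<le> bump (x - r) (x + r) x"
proof (cases "x - r < s \<and> s < x + r")
  case True
  define a where "a = s - (x - r)"
  define b where "b = x + r - s"
  have ab: "a > 0" "b > 0" "a + b = 2 * r" using True by (auto simp: a_def b_def)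
  have "4 * (a * b) = (a + b)^2 - (a - b)^2" by (simp add: power2_eq_square algebra_simps)
  moreover have "0 \<le> (a - b)^2" by simp
  ultimately have "4 * (a * b) \<le> (2 * r)^2" using ab(3) by simp
  then have "a * b \<le> r * r" by (simp add: power2_eq_square)
  then have "(1 / a + 1 / b) \<ge> 2 / r"
    using ab assms by (simp add: field_simps)
  then show ?thesis using True assms
    by (simp add: bump_def flat_exp_def flip: exp_add a_def b_def)
qed (use bump_nonneg bump_eq_0_iff in metis)

lemma test_function_bump: "test_function (bump l u)"
proof -
  have "cont_diff k (\<lambda>s. flat_exp 1 (- l + 1 * s) * flat_exp 1 (u + (-1) * s))" for k
    by (intro cont_diff_mult cont_diff_flat_exp_affine)
  then have "cont_diff k (bump l u)" for k by (simp add: bump_def[abs_def])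
  moreover have "bump l u s = 0" if "s \<notin> {l..u}" for s
    using that by (auto simp: bump_eq_0_iff)
  ultimately show ?thesis unfolding test_function_def by blast
qed

lemma deriv_eq_0_outside_Icc:
  fixes f :: "real \<Rightarrow> real"
  assumes "\<And>s. s \<notin> {l..u} \<Longrightarrow> f s = 0" and "s \<notin> {l..u}"
  shows "deriv f s = 0"
proof -
  have "\<forall>\<^sub>F x in nhds s. x \<in> - {l..u}"
    using assms(2) by (intro eventually_nhds_in_open open_Compl closed_atLeastAtMost) auto
  then have "\<forall>\<^sub>F x in nhds s. f x = 0"
    by eventually_elim (auto intro: assms(1))
  then have "(f has_real_derivative 0) (at s)"
    by (subst DERIV_cong_ev[OF refl _ refl]) auto
  then show ?thesis by (rule DERIV_imp_deriv)
qed

lemma test_function_deriv: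
  assumes "test_function f"
  shows "test_function (deriv f)"
proof -
  from assms obtain l u where 0: "\<And>s. s \<notin> {l..u} \<Longrightarrow> f s = 0" and f: "\<And>k. cont_diff k f"
    unfolding test_function_def by blast
  have "cont_diff k (deriv f)" for k using f[of "Suc k"] by simp
  moreover have "deriv f s = 0" if "s \<notin> {l..u}" for s
    using 0 that by (rule deriv_eq_0_outside_Icc)
  ultimately show ?thesis unfolding test_function_def by blast
qed

lemma test_function_has_deriv: "test_function f \<Longrightarrow> (f has_real_derivative deriv f s) (at s)"
  unfolding test_function_def using cont_diff.simps(2)[of 0 f] by blast

lemma test_function_continuous: "test_function f \<Longrightarrow> continuous_on A f"
  unfolding test_function_def using cont_diff.simps(1)[of f] continuous_on_subset by blast

lemma deriv_bump_outside: "s \<notin> {l..u} \<Longrightarrow> deriv (bump l u) s = 0"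
  by (rule deriv_eq_0_outside_Icc) (auto simp: bump_eq_0_iff)

section \<open>Fourier inversion on the line\<close>

definition fourier1 :: "(real \<Rightarrow> real) \<Rightarrow> real \<Rightarrow> complex" where
  "fourier1 f s = (\<integral>x. exp (- \<i> * of_real (s * x)) * of_real (f x) \<partial>lborel)"

lemma test_function_measurable: "test_function f \<Longrightarrow> f \<in> borel_measurable borel"
  by (intro borel_measurable_continuous_onI test_function_continuous)

lemma test_function_integrable_mult:
  fixes g :: "real \<Rightarrow> complex"
  assumes f: "test_function f" and g: "continuous_on UNIV g"
  shows "integrable lborel (\<lambda>x. g x * of_real (f x))"
proof -
  from f obtain l u where 0: "\<And>s. s \<notin> {l..u} \<Longrightarrow> f s = 0"
    unfolding test_function_def by blast
  have "continuous_on {l..u} (\<lambda>x. g x * of_real (f x))"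
    by (intro continuous_intros test_function_continuous f continuous_on_subset[OF g]) auto
  then have "integrable lborel (\<lambda>x. indicator {l..u} x *\<^sub>R (g x * of_real (f x)))"
    using borel_integrable_atLeastAtMost' unfolding set_integrable_def by blast
  also have "(\<lambda>x. indicator {l..u} x *\<^sub>R (g x * of_real (f x))) = (\<lambda>x. g x * of_real (f x))"
    using 0 by (auto simp: indicator_def fun_eq_iff)
  finally show ?thesis .
qed

lemma test_function_integrable: "test_function f \<Longrightarrow> integrable lborel f"
  using test_function_integrable_mult[of f "\<lambda>_. 1"] by (simp add: complex_of_real_integrable_eq)

text \<open>Integration by parts: there are no boundary terms, as \<open>f\<close> vanishes near the ends of a slightly larger
  interval.\<close>
lemma test_function_integral_deriv_mult:
  fixes g g' :: "real \<Rightarrow> complex"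
  assumes f: "test_function f"
    and g: "\<And>x. (g has_vector_derivative g' x) (at x)" and g': "continuous_on UNIV g'"
  shows "(\<integral>x. g x * of_real (deriv f x) \<partial>lborel) = - (\<integral>x. g' x * of_real (f x) \<partial>lborel)"
proof -
  from f obtain l u where 0: "\<And>s. s \<notin> {l..u} \<Longrightarrow> f s = 0"
    unfolding test_function_def by blast
  define a where "a = min l u - 1"
  define b where "b = max l u + 1"
  have ab: "a \<le> b" "f a = 0" "f b = 0" by (auto simp: a_def b_def intro!: 0)
  have z: "f x = 0 \<and> deriv f x = 0" if "x \<notin> {a..b}" for x
  proof -
    from that have "x \<notin> {l..u}" by (auto simp: a_def b_def)
    then show ?thesis using 0[of x] deriv_eq_0_outside_Icc[of l u f x] 0 by blast
  qed
  have cg: "continuous_on UNIV g"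
    using g by (intro continuous_at_imp_continuous_on ballI has_vector_derivative_continuous)
  let ?h = "\<lambda>x. g x * of_real (deriv f x) + g' x * of_real (f x)"
  have df: "((\<lambda>x. complex_of_real (f x)) has_vector_derivative of_real (deriv f x)) (at x)" for x
    using test_function_has_deriv[OF f, of x]
    by (intro has_vector_derivative_of_real) (simp add: has_real_derivative_iff_has_vector_derivative)
  have "(\<integral>x. indicator {a..b} x *\<^sub>R ?h x \<partial>lborel) = g b * of_real (f b) - g a * of_real (f a)"
  proof (rule integral_FTC_Icc[OF ab(1)])
    show "((\<lambda>x. g x * of_real (f x)) has_vector_derivative ?h x) (at x within {a..b})" for x
      by (rule has_vector_derivative_at_within, rule has_vector_derivative_mult[OF g df])
    show "continuous_on {a..b} ?h"
      by (intro continuous_intros test_function_continuous f test_function_deriv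
          continuous_on_subset[OF cg] continuous_on_subset[OF g']) auto
  qed
  also have "(\<lambda>x. indicator {a..b} x *\<^sub>R ?h x) = ?h"
    using z by (auto simp: indicator_def fun_eq_iff)
  also have "(\<integral>x. ?h x \<partial>lborel) =
      (\<integral>x. g x * of_real (deriv f x) \<partial>lborel) + (\<integral>x. g' x * of_real (f x) \<partial>lborel)"
    by (intro Bochner_Integration.integral_add test_function_integrable_mult f test_function_deriv cg g')
  finally show ?thesis using ab by (simp add: eq_neg_iff_add_eq_0)
qed

lemma fourier1_deriv:
  assumes "test_function f"
  shows "fourier1 (deriv f) s = \<i> * of_real s * fourier1 f s"
proof -
  have "fourier1 (deriv f) s = - (\<integral>x. (- \<i> * of_real s * exp (- \<i> * of_real (s * x))) * of_real (f x) \<partial>lborel)"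
    unfolding fourier1_def
  proof (rule test_function_integral_deriv_mult[OF assms])
    have "((\<lambda>x. exp (- \<i> * of_real s * x)) has_field_derivative
         - \<i> * of_real s * exp (- \<i> * of_real s * of_real x)) (at (of_real x))" for x :: real
      by (auto intro!: derivative_eq_intros)
    from field_vector_diff_chain_at[OF has_vector_derivative_of_real[OF DERIV_ident] this]
    show "((\<lambda>x. exp (- \<i> * of_real (s * x))) has_vector_derivative
         - \<i> * of_real s * exp (- \<i> * of_real (s * x))) (at x)" for x
      by (simp add: o_def mult.assoc)
  qed (intro continuous_intros)
  also have "\<dots> = \<i> * of_real s * fourier1 f s"
    unfolding fourier1_def by (simp add: mult.assoc)
  finally show ?thesis .
qed

lemma fourier1_bound: "cmod (fourier1 f s) \<le> (\<integral>x. \<bar>f x\<bar> \<partial>lborel)"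
  unfolding fourier1_def
  by (rule order_trans[OF integral_norm_bound]) (simp add: norm_mult)

lemma fourier1_measurable:
  assumes "test_function f"
  shows "fourier1 f \<in> borel_measurable borel"
proof -
  note [measurable] = test_function_measurable[OF assms]
  show ?thesis unfolding fourier1_def[abs_def] by measurable
qed

lemma integrable_inverse_1_plus_square_UNIV: "integrable lborel (\<lambda>s :: real. inverse (1 + s\<^sup>2))"
  using integrable_inverse_1_plus_square by (simp add: set_integrable_def einterval_def)

text \<open>Each derivative of \<open>f\<close> costs a factor \<open>s\<close> on the Fourier side, and Fourier transforms of integrable
  functions are bounded. Four derivatives therefore bound \<open>(1 + s\<^sup>2)\<^sup>2\<close> times the transform. The
  remaining weight \<open>1 + s\<^sup>2\<close> is what is needed to integrate against a symbol, which grows at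
  most quadratically.\<close>
lemma fourier1_integrable:
  assumes "test_function f"
  shows "integrable lborel (\<lambda>s. (1 + s\<^sup>2) * cmod (fourier1 f s))"
proof -
  let ?M = "\<lambda>f. \<integral>x. \<bar>f x\<bar> \<partial>lborel"
  define C where "C = ?M f + 2 * ?M (deriv (deriv f)) + ?M (deriv (deriv (deriv (deriv f))))"
  note d = assms assms[THEN test_function_deriv] assms[THEN test_function_deriv, THEN test_function_deriv]
     assms[THEN test_function_deriv, THEN test_function_deriv, THEN test_function_deriv]
  have "(1 + s\<^sup>2) * cmod (fourier1 f s) \<le> C * inverse (1 + s\<^sup>2)" for s
  proof -
    have 2: "cmod (fourier1 (deriv (deriv f)) s) = s\<^sup>2 * cmod (fourier1 f s)"
      by (simp add: fourier1_deriv d norm_mult power2_eq_square)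
    have 4: "cmod (fourier1 (deriv (deriv (deriv (deriv f)))) s) = s\<^sup>2 * s\<^sup>2 * cmod (fourier1 f s)"
      by (simp add: fourier1_deriv d norm_mult power2_eq_square)
    have "(1 + s\<^sup>2) * ((1 + s\<^sup>2) * cmod (fourier1 f s)) =
        cmod (fourier1 f s) + 2 * cmod (fourier1 (deriv (deriv f)) s)
          + cmod (fourier1 (deriv (deriv (deriv (deriv f)))) s)"
      unfolding 2 4 by (simp add: algebra_simps)
    also have "\<dots> \<le> C"
      unfolding C_def by (intro add_mono mult_left_mono fourier1_bound) auto
    finally show ?thesis
      by (simp add: divide_inverse[symmetric] pos_le_divide_eq add_pos_nonneg mult.commute)
  qed
  note * = this
  note [measurable] = fourier1_measurable[OF assms]
  show ?thesis
  proof (rule Bochner_Integration.integrable_bound[OF integrable_mult_right[OF integrable_inverse_1_plus_square_UNIV, of C]])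
    show "AE s in lborel. norm ((1 + s\<^sup>2) * cmod (fourier1 f s)) \<le> norm (C * inverse (1 + s\<^sup>2))"
      unfolding real_norm_def using order_trans[OF * abs_ge_self]
      by (subst abs_of_nonneg) auto
  qed measurable
qed

lemma (in pair_sigma_finite) integrable_product:
  fixes f :: "'a \<Rightarrow> real" and g :: "'b \<Rightarrow> real"
  assumes f: "integrable M1 f" and g: "integrable M2 g"
  shows "integrable (M1 \<Otimes>\<^sub>M M2) (\<lambda>(x, y). f x * g y)"
proof (rule Fubini_integrable)
  note [measurable] = borel_measurable_integrable[OF f] borel_measurable_integrable[OF g]
  show "(\<lambda>(x, y). f x * g y) \<in> borel_measurable (M1 \<Otimes>\<^sub>M M2)" by measurable
  show "integrable M1 (\<lambda>x. \<integral>y. norm (case (x, y) of (x, y) \<Rightarrow> f x * g y) \<partial>M2)"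
    using f by (simp add: abs_mult)
  show "AE x in M1. integrable M2 (\<lambda>y. case (x, y) of (x, y) \<Rightarrow> f x * g y)"
    using g by simp
qed

text \<open>The Gaussian density is, up to scaling, its own Fourier transform; this is the known characteristic
  function of the standard normal distribution after the substitution \<open>u = \<epsilon> s\<close>.\<close>
lemma integral_iexp_gaussian:
  assumes "\<epsilon> > 0"
  shows "(\<integral>s. exp (\<i> * of_real (s * w)) * of_real (exp (- (\<epsilon> * s)\<^sup>2 / 2)) \<partial>lborel) =
    of_real (sqrt (2 * pi) / \<epsilon> * exp (- (w / \<epsilon>)\<^sup>2 / 2))"
proof -
  have std: "(\<integral>u. exp (\<i> * of_real (u * t)) * of_real (exp (- u\<^sup>2 / 2)) \<partial>lborel) =
      complex_of_real (sqrt (2 * pi) * exp (- t\<^sup>2 / 2))" for t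
  proof -
    have "complex_of_real (exp (- t\<^sup>2 / 2)) =
        (\<integral>u. exp (\<i> * of_real (t * u)) \<partial>density lborel std_normal_density)"
      using fun_cong[OF char_std_normal_distribution, of t] by (simp add: char_def)
    also have "\<dots> = (\<integral>u. std_normal_density u *\<^sub>R exp (\<i> * of_real (t * u)) \<partial>lborel)"
      by (intro integral_density) auto
    also have "\<dots> = (\<integral>u. of_real (1 / sqrt (2 * pi)) * (exp (\<i> * of_real (u * t)) * of_real (exp (- u\<^sup>2 / 2))) \<partial>lborel)"
      by (intro Bochner_Integration.integral_cong)
         (auto simp: std_normal_density_def scaleR_conv_of_real mult_ac)
    also have "\<dots> = of_real (1 / sqrt (2 * pi)) * (\<integral>u. (exp (\<i> * of_real (u * t)) * of_real (exp (- u\<^sup>2 / 2))) \<partial>lborel)"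
      by simp
    finally show ?thesis by (simp add: field_simps)
  qed
  have "complex_of_real (sqrt (2 * pi) * exp (- (w / \<epsilon>)\<^sup>2 / 2)) =
     \<bar>\<epsilon>\<bar> *\<^sub>R (\<integral>s. exp (\<i> * of_real ((0 + \<epsilon> * s) * (w / \<epsilon>))) * of_real (exp (- (0 + \<epsilon> * s)\<^sup>2 / 2)) \<partial>lborel)"
    unfolding std[symmetric] using assms by (intro lborel_integral_real_affine) auto
  moreover have "(0 + \<epsilon> * s) * (w / \<epsilon>) = s * w" for s
    using assms by simp
  ultimately show ?thesis
    using assms by (simp add: scaleR_conv_of_real eq_divide_eq mult.commute)
qed

text \<open>A Gaussian factor makes the double integral in Fourier inversion absolutely convergent. Exchanging
  the integrals then shows that it amounts to averaging \<open>f\<close> over a normal distribution around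
  \<open>x\<close> with standard deviation \<open>\<epsilon>\<close>.\<close>
lemma integral_gaussian_kernel:
  assumes f: "test_function f" and "\<epsilon> > 0"
  shows "(\<integral>s. exp (\<i> * of_real (s * x)) * fourier1 f s * of_real (exp (- (\<epsilon> * s)\<^sup>2 / 2)) \<partial>lborel) =
    of_real (2 * pi * (\<integral>z. f (x + \<epsilon> * z) * std_normal_density z \<partial>lborel))"
proof -
  note [measurable] = test_function_measurable[OF f]
  let ?G = "\<lambda>s. exp (- (\<epsilon> * s)\<^sup>2 / 2) :: real"
  let ?k = "\<lambda>s y. exp (\<i> * of_real (s * (x - y))) * of_real (?G s) * complex_of_real (f y)"
  have intG: "integrable lborel ?G"
  proof -
    have "integrable lborel (\<lambda>s. sqrt (2 * pi) * std_normal_density (0 + \<epsilon> * s))"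
      using assms(2) by (intro integrable_mult_right lborel_integrable_real_affine) auto
    then show ?thesis by (simp add: std_normal_density_def)
  qed
  have int: "integrable (lborel \<Otimes>\<^sub>M lborel) (\<lambda>(s, y). ?k s y)"
    by (rule Bochner_Integration.integrable_bound[OF lborel_pair.integrable_product[OF intG test_function_integrable[OF f]]])
       (auto simp: norm_mult)
  have "exp (\<i> * of_real (s * x)) * fourier1 f s * of_real (?G s) = (\<integral>y. ?k s y \<partial>lborel)" for s
  proof -
    have "exp (\<i> * of_real (s * x)) * of_real (?G s) * fourier1 f s =
      (\<integral>y. (exp (\<i> * of_real (s * x)) * of_real (?G s)) * (exp (- \<i> * of_real (s * y)) * of_real (f y)) \<partial>lborel)"
      unfolding fourier1_def by simp
    also have "\<dots> = (\<integral>y. ?k s y \<partial>lborel)"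
    proof (intro Bochner_Integration.integral_cong refl)
      fix y
      have "exp (\<i> * of_real (s * (x - y))) = exp (\<i> * of_real (s * x)) * exp (- \<i> * of_real (s * y))"
        by (simp add: exp_add[symmetric] algebra_simps)
      then show "exp (\<i> * of_real (s * x)) * of_real (?G s) * (exp (- \<i> * of_real (s * y)) * of_real (f y)) = ?k s y"
        by (simp only: mult_ac)
    qed
    finally show ?thesis by (simp only: mult_ac)
  qed
  then have "(\<integral>s. exp (\<i> * of_real (s * x)) * fourier1 f s * of_real (?G s) \<partial>lborel) =
      (\<integral>s. (\<integral>y. ?k s y \<partial>lborel) \<partial>lborel)" by simp
  also have "\<dots> = (\<integral>y. (\<integral>s. ?k s y \<partial>lborel) \<partial>lborel)"
    using lborel_pair.Fubini_integral[OF int] by simp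
  also have "\<dots> = (\<integral>y. of_real (sqrt (2 * pi) / \<epsilon> * exp (- ((x - y) / \<epsilon>)\<^sup>2 / 2) * f y) \<partial>lborel)"
    by (simp only: integral_mult_left_zero integral_iexp_gaussian[OF assms(2)]) simp
  also have "\<dots> = of_real (\<integral>y. sqrt (2 * pi) / \<epsilon> * exp (- ((x - y) / \<epsilon>)\<^sup>2 / 2) * f y \<partial>lborel)"
    by (rule integral_complex_of_real)
  also have "(\<integral>y. sqrt (2 * pi) / \<epsilon> * exp (- ((x - y) / \<epsilon>)\<^sup>2 / 2) * f y \<partial>lborel) =
     \<bar>\<epsilon>\<bar> *\<^sub>R (\<integral>z. sqrt (2 * pi) / \<epsilon> * exp (- ((x - (x + \<epsilon> * z)) / \<epsilon>)\<^sup>2 / 2) * f (x + \<epsilon> * z) \<partial>lborel)"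
    using assms(2) by (intro lborel_integral_real_affine) auto
  also have "\<dots> = 2 * pi * (\<integral>z. f (x + \<epsilon> * z) * std_normal_density z \<partial>lborel)"
  proof -
    have eq: "\<epsilon> * (sqrt (2 * pi) / \<epsilon> * exp (- ((x - (x + \<epsilon> * z)) / \<epsilon>)\<^sup>2 / 2) * f (x + \<epsilon> * z)) =
       2 * pi * (f (x + \<epsilon> * z) * std_normal_density z)" for z
    proof -
      have "2 * pi * (f (x + \<epsilon> * z) * std_normal_density z) =
          (2 * pi / sqrt (2 * pi)) * exp (- z\<^sup>2 / 2) * f (x + \<epsilon> * z)"
        by (simp add: std_normal_density_def)
      also have "2 * pi / sqrt (2 * pi) = sqrt (2 * pi)" by (rule real_div_sqrt) simp
      also have "z\<^sup>2 = ((x - (x + \<epsilon> * z)) / \<epsilon>)\<^sup>2"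
        using assms(2) by (simp add: power2_eq_square)
      finally have "2 * pi * (f (x + \<epsilon> * z) * std_normal_density z) =
          sqrt (2 * pi) * exp (- ((x - (x + \<epsilon> * z)) / \<epsilon>)\<^sup>2 / 2) * f (x + \<epsilon> * z)" .
      moreover have "\<epsilon> * (sqrt (2 * pi) / \<epsilon> * e * c) = sqrt (2 * pi) * e * c" for e c
        using assms(2) by simp
      ultimately show ?thesis by (simp only:)
    qed
    have "\<bar>\<epsilon>\<bar> = \<epsilon>" using assms(2) by simp
    then show ?thesis
      by (simp only: real_scaleR_def integral_mult_right_zero[symmetric] eq)
  qed
  finally show ?thesis .
qed

text \<open>Let \<open>\<epsilon>\<close> tend to \<open>0\<close> in the preceding identity, with dominated convergence on both sides.\<close>
lemma fourier1_inversion: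
  assumes f: "test_function f"
  shows "(\<integral>s. exp (\<i> * of_real (s * x)) * fourier1 f s \<partial>lborel) = of_real (2 * pi * f x)"
proof -
  define \<epsilon> :: "nat \<Rightarrow> real" where "\<epsilon> n = 1 / real (Suc n)" for n
  have \<epsilon>: "\<epsilon> n > 0" for n by (simp add: \<epsilon>_def)
  have \<epsilon>0: "\<epsilon> \<longlonglongrightarrow> 0" unfolding \<epsilon>_def[abs_def] by (rule lim_1_over_n[THEN LIMSEQ_Suc])
  note [measurable] = test_function_measurable[OF f] fourier1_measurable[OF f]
  let ?L = "\<lambda>n. \<integral>s. exp (\<i> * of_real (s * x)) * fourier1 f s * of_real (exp (- (\<epsilon> n * s)\<^sup>2 / 2)) \<partial>lborel"
  have "?L \<longlonglongrightarrow> (\<integral>s. exp (\<i> * of_real (s * x)) * fourier1 f s \<partial>lborel)"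
  proof (rule integral_dominated_convergence[OF _ _ fourier1_integrable[OF f]])
    show "AE s in lborel. (\<lambda>n. exp (\<i> * of_real (s * x)) * fourier1 f s * of_real (exp (- (\<epsilon> n * s)\<^sup>2 / 2)))
       \<longlonglongrightarrow> exp (\<i> * of_real (s * x)) * fourier1 f s"
    proof (intro always_eventually allI)
      fix s
      have "(\<lambda>n. exp (\<i> * of_real (s * x)) * fourier1 f s * of_real (exp (- (\<epsilon> n * s)\<^sup>2 / 2)))
       \<longlonglongrightarrow> exp (\<i> * of_real (s * x)) * fourier1 f s * of_real (exp (- (0 * s)\<^sup>2 / 2))"
        by (intro tendsto_intros \<epsilon>0) auto
      then show "(\<lambda>n. exp (\<i> * of_real (s * x)) * fourier1 f s * of_real (exp (- (\<epsilon> n * s)\<^sup>2 / 2)))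
       \<longlonglongrightarrow> exp (\<i> * of_real (s * x)) * fourier1 f s" by simp
    qed
    show "AE s in lborel. norm (exp (\<i> * of_real (s * x)) * fourier1 f s * of_real (exp (- (\<epsilon> n * s)\<^sup>2 / 2)))
        \<le> (1 + s\<^sup>2) * cmod (fourier1 f s)" for n
    proof (intro always_eventually allI)
      fix s
      have "exp (- (\<epsilon> n * s)\<^sup>2 / 2) \<le> 1 + s\<^sup>2"
        by (rule order_trans[of _ 1]) auto
      from mult_left_mono[OF this, of "cmod (fourier1 f s)"]
      show "norm (exp (\<i> * of_real (s * x)) * fourier1 f s * of_real (exp (- (\<epsilon> n * s)\<^sup>2 / 2)))
        \<le> (1 + s\<^sup>2) * cmod (fourier1 f s)"
        by (simp add: norm_mult mult_ac)
    qed
  qed measurable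
  moreover have "?L \<longlonglongrightarrow> of_real (2 * pi * (\<integral>z. f x * std_normal_density z \<partial>lborel))"
    unfolding integral_gaussian_kernel[OF f \<epsilon>]
  proof (intro tendsto_of_real tendsto_mult tendsto_const)
    have "bounded (range f)"
    proof -
      from f obtain l u where 0: "\<And>s. s \<notin> {l..u} \<Longrightarrow> f s = 0"
        unfolding test_function_def by blast
      have "bounded (insert 0 (f ` {l..u}))"
        by (simp add: compact_imp_bounded compact_continuous_image test_function_continuous f)
      moreover have "range f \<subseteq> insert 0 (f ` {l..u})" using 0 by blast
      ultimately show ?thesis by (rule bounded_subset)
    qed
    then obtain B where B: "\<And>s. \<bar>f s\<bar> \<le> B" by (auto simp: bounded_iff)
    show "(\<lambda>n. \<integral>z. f (x + \<epsilon> n * z) * std_normal_density z \<partial>lborel) \<longlonglongrightarrow> (\<integral>z. f x * std_normal_density z \<partial>lborel)"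
    proof (rule integral_dominated_convergence[where w = "\<lambda>z. B * std_normal_density z"])
      show "AE z in lborel. (\<lambda>n. f (x + \<epsilon> n * z) * std_normal_density z) \<longlonglongrightarrow> f x * std_normal_density z"
      proof (intro always_eventually allI tendsto_mult tendsto_const)
        fix z
        have "(\<lambda>n. x + \<epsilon> n * z) \<longlonglongrightarrow> x + 0 * z" by (intro tendsto_intros \<epsilon>0)
        moreover have "isCont f x" using test_function_continuous[OF f, of UNIV]
          by (simp add: continuous_on_eq_continuous_at)
        ultimately show "(\<lambda>n. f (x + \<epsilon> n * z)) \<longlonglongrightarrow> f x"
          by (intro isCont_tendsto_compose[of x f]) simp_all
      qed
      show "AE z in lborel. norm (f (x + \<epsilon> n * z) * std_normal_density z) \<le> B * std_normal_density z" for n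
        by (auto intro!: always_eventually mult_right_mono B simp: abs_mult)
    qed auto
  qed
  ultimately have "(\<integral>s. exp (\<i> * of_real (s * x)) * fourier1 f s \<partial>lborel) =
     of_real (2 * pi * (\<integral>z. f x * std_normal_density z \<partial>lborel))"
    by (rule LIMSEQ_unique)
  then show ?thesis by simp
qed

section \<open>Products of one-dimensional test functions\<close>

lemma Ck_SucI:
  assumes "\<And>x. (f has_derivative f' x) (at x)" and "\<And>i. Ck k (\<lambda>x. f' x (axis i 1))"
  shows "Ck (Suc k) f"
proof -
  have "frechet_derivative f (at x) = f' x" for x
    using assms(1) by (metis frechet_derivative_at)
  with assms show ?thesis by (auto simp: differentiable_def)
qed

lemma Ck_Suc_has_derivative:
  "Ck (Suc k) f \<Longrightarrow> (f has_derivative frechet_derivative f (at x)) (at x)"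
  by (simp add: frechet_derivative_works)

lemma Ck_decrease: "Ck (Suc k) f \<Longrightarrow> Ck k f"
proof (induction k arbitrary: f)
  case 0 then show ?case
    by (auto intro!: continuous_at_imp_continuous_on differentiable_imp_continuous_within)
qed auto

lemma Ck_const: "Ck k (\<lambda>x. c)"
proof (induction k arbitrary: c)
  case (Suc k) then show ?case
    by (intro Ck_SucI[where f' = "\<lambda>x h. 0"]) auto
qed auto

lemma Ck_add: "Ck k f \<Longrightarrow> Ck k g \<Longrightarrow> Ck k (\<lambda>x. f x + g x)"
proof (induction k arbitrary: f g)
  case (Suc k)
  show ?case
  proof (rule Ck_SucI)
    show "((\<lambda>x. f x + g x) has_derivative
        (\<lambda>h. frechet_derivative f (at x) h + frechet_derivative g (at x) h)) (at x)" for x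
      by (intro has_derivative_add Ck_Suc_has_derivative[OF Suc.prems(1)] Ck_Suc_has_derivative[OF Suc.prems(2)])
    show "Ck k (\<lambda>x. frechet_derivative f (at x) (axis i 1) + frechet_derivative g (at x) (axis i 1))" for i
      using Suc.prems by (intro Suc.IH) auto
  qed
qed (auto intro: continuous_intros)

lemma Ck_mult: "Ck k f \<Longrightarrow> Ck k g \<Longrightarrow> Ck k (\<lambda>x. f x * g x)"
proof (induction k arbitrary: f g)
  case (Suc k)
  show ?case
  proof (rule Ck_SucI)
    show "((\<lambda>x. f x * g x) has_derivative
        (\<lambda>h. f x * frechet_derivative g (at x) h + frechet_derivative f (at x) h * g x)) (at x)" for x
      by (intro has_derivative_mult Ck_Suc_has_derivative[OF Suc.prems(1)] Ck_Suc_has_derivative[OF Suc.prems(2)])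
    show "Ck k (\<lambda>x. f x * frechet_derivative g (at x) (axis i 1) + frechet_derivative f (at x) (axis i 1) * g x)" for i
      using Suc.prems by (intro Ck_add Suc.IH) (auto intro: Ck_decrease)
  qed
qed (auto intro: continuous_intros)

lemma Ck_prod: "finite A \<Longrightarrow> (\<And>a. a \<in> A \<Longrightarrow> Ck k (f a)) \<Longrightarrow> Ck k (\<lambda>x. \<Prod>a\<in>A. f a x)"
  by (induction A rule: finite_induct) (auto intro: Ck_const Ck_mult)

lemma Ck_component:
  assumes "cont_diff k \<phi>"
  shows "Ck k (\<lambda>x. \<phi> (x $ i))"
  using assms
proof (induction k arbitrary: \<phi>)
  case 0
  then show ?case by (auto intro!: continuous_on_compose2[of UNIV \<phi>] continuous_intros)
next
  case (Suc k)
  show ?case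
  proof (rule Ck_SucI)
    show "((\<lambda>x. \<phi> (x $ i)) has_derivative (\<lambda>h. deriv \<phi> (x $ i) * h $ i)) (at x)" for x
    proof -
      have "(\<phi> has_derivative (\<lambda>t. deriv \<phi> (x $ i) * t)) (at (x $ i))"
        using Suc.prems by (auto simp: has_field_derivative_def)
      from has_derivative_compose[OF bounded_linear_imp_has_derivative[OF bounded_linear_vec_nth] this]
      show ?thesis .
    qed
    show "Ck k (\<lambda>x. deriv \<phi> (x $ i) * axis j 1 $ i)" for j
      using Suc by (intro Ck_mult Ck_const Suc.IH) auto
  qed
qed

definition tensor :: "('n::finite \<Rightarrow> real \<Rightarrow> real) \<Rightarrow> real ^ 'n \<Rightarrow> real" where
  "tensor \<phi> x = (\<Prod>k\<in>UNIV. \<phi> k (x $ k))"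

definition tensor_fourier :: "('n::finite \<Rightarrow> real \<Rightarrow> real) \<Rightarrow> real ^ 'n \<Rightarrow> complex" where
  "tensor_fourier \<phi> \<xi> = (\<Prod>k\<in>UNIV. fourier1 (\<phi> k) (\<xi> $ k))"

lemma tensor_Cc_infinity:
  assumes "\<And>k. test_function (\<phi> k)"
  shows "tensor \<phi> \<in> Cc_infinity"
proof -
  have "Ck m (tensor \<phi>)" for m
    unfolding tensor_def[abs_def] using assms
    by (intro Ck_prod Ck_component) (auto simp: test_function_def)
  moreover have "compact (closure {x. tensor \<phi> x \<noteq> 0})"
  proof -
    have "\<forall>k. \<exists>l u. \<forall>s. s \<notin> {l..u} \<longrightarrow> \<phi> k s = 0"
      using assms unfolding test_function_def by blast
    then obtain l u where lu: "\<And>k s. s \<notin> {l k..u k} \<Longrightarrow> \<phi> k s = 0" by metis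
    have "{x. tensor \<phi> x \<noteq> 0} \<subseteq> cbox (\<chi> k. l k) (\<chi> k. u k)"
    proof clarify
      fix x assume "tensor \<phi> x \<noteq> 0"
      then have "\<phi> k (x $ k) \<noteq> 0" for k by (simp add: tensor_def)
      then have "x $ k \<in> {l k..u k}" for k using lu by blast
      then show "x \<in> cbox (\<chi> k. l k) (\<chi> k. u k)" by (simp add: mem_box_cart)
    qed
    then show ?thesis
      using bounded_subset[OF bounded_cbox] bounded_closure closed_closure compact_eq_bounded_closed by blast
  qed
  ultimately show ?thesis by (simp add: Cc_infinity_def)
qed

lemma vec_nth_measurable [measurable]: "(\<lambda>x :: real ^ 'n. x $ k) \<in> borel_measurable borel"
  by (intro borel_measurable_continuous_onI continuous_intros)

lemma
  fixes h :: "'n::finite \<Rightarrow> real \<Rightarrow> 'b::{real_normed_field, banach, second_countable_topology}"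
  assumes h: "\<And>k. integrable lborel (h k)"
  shows integrable_lborel_prod: "integrable lborel (\<lambda>x :: real ^ 'n. \<Prod>k\<in>UNIV. h k (x $ k))"
    and integral_lborel_prod: "(\<integral>x. (\<Prod>k\<in>UNIV. h k ((x :: real ^ 'n) $ k)) \<partial>lborel) = (\<Prod>k\<in>UNIV. \<integral>s. h k s \<partial>lborel)"
proof -
  interpret product_sigma_finite "\<lambda>_ :: real ^ 'n. lborel :: real measure" by standard
  let ?e = "\<lambda>k :: 'n. axis k (1 :: real)"
  let ?T = "\<lambda>f :: real ^ 'n \<Rightarrow> real. \<Sum>b\<in>Basis. f b *\<^sub>R b"
  define h' where "h' b = h (THE k. b = ?e k)" for b
  have h'[simp]: "h' (?e k) = h k" for k by (simp add: h'_def axis_eq_axis)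
  have inj: "inj ?e" by (auto intro!: injI simp: axis_eq_axis)
  have B: "(Basis :: (real ^ 'n) set) = range ?e" by (auto simp: Basis_vec_def)
  have T: "?T f $ k = f (?e k)" for f k
  proof -
    have "?T f $ k = ?T f \<bullet> ?e k" by (simp add: inner_axis)
    also have "\<dots> = f (?e k)" by (rule inner_sum_left_Basis) simp
    finally show ?thesis .
  qed
  have eq: "(\<Prod>k\<in>UNIV. h k (?T f $ k)) = (\<Prod>b\<in>Basis. h' b (f b))" for f
  proof -
    have "(\<Prod>k\<in>UNIV. h k (?T f $ k)) = (\<Prod>k\<in>UNIV. h k (f (?e k)))" by (simp only: T)
    then show ?thesis by (simp add: B prod.reindex[OF inj])
  qed
  have h'_int: "integrable lborel (h' b)" if "b \<in> Basis" for b
    using that h by (auto simp: B)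
  have [measurable]: "h k \<in> borel_measurable borel" for k
    using borel_measurable_integrable[OF h[of k]] by simp
  have [measurable]: "?T \<in> (\<Pi>\<^sub>M b\<in>Basis. lborel) \<rightarrow>\<^sub>M borel" by measurable
  have [measurable]: "(\<lambda>x :: real ^ 'n. \<Prod>k\<in>UNIV. h k (x $ k)) \<in> borel_measurable borel"
    by (intro borel_measurable_prod measurable_compose[OF vec_nth_measurable]) measurable
  have "integrable (\<Pi>\<^sub>M b\<in>Basis. lborel) (\<lambda>f. \<Prod>k\<in>UNIV. h k (?T f $ k))"
    unfolding eq by (intro product_integrable_prod h'_int) auto
  then show "integrable lborel (\<lambda>x :: real ^ 'n. \<Prod>k\<in>UNIV. h k (x $ k))"
    by (subst lborel_eq) (simp add: integrable_distr_eq)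
  have "(\<integral>x. (\<Prod>k\<in>UNIV. h k ((x :: real ^ 'n) $ k)) \<partial>lborel) =
      (\<integral>f. (\<Prod>k\<in>UNIV. h k (?T f $ k)) \<partial>(\<Pi>\<^sub>M b\<in>(Basis :: (real ^ 'n) set). lborel))"
    by (subst lborel_eq) (simp add: integral_distr)
  also have "\<dots> = (\<Prod>b\<in>Basis. \<integral>s. h' b s \<partial>lborel)"
    unfolding eq by (intro product_integral_prod h'_int) auto
  also have "\<dots> = (\<Prod>k\<in>UNIV. \<integral>s. h k s \<partial>lborel)"
    unfolding B by (simp add: prod.reindex[OF inj])
  finally show "(\<integral>x. (\<Prod>k\<in>UNIV. h k ((x :: real ^ 'n) $ k)) \<partial>lborel) = (\<Prod>k\<in>UNIV. \<integral>s. h k s \<partial>lborel)" .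
qed

lemma exp_inner_eq_prod:
  fixes \<xi> x :: "real ^ 'n"
  shows "exp (c * of_real (\<xi> \<bullet> x)) = (\<Prod>k\<in>UNIV. exp (c * complex_of_real (\<xi> $ k * x $ k)))"
  by (simp add: inner_vec_def sum_distrib_left exp_sum)

lemma fourier_tensor:
  fixes \<phi> :: "'n::finite \<Rightarrow> real \<Rightarrow> real"
  assumes "\<And>k. test_function (\<phi> k)"
  shows "fourier (tensor \<phi>) \<xi> = of_real ((2 * pi) powr (- (real CARD('n) / 2))) * tensor_fourier \<phi> \<xi>"
proof -
  have "(\<integral>x. exp (- \<i> * of_real (\<xi> \<bullet> x)) * of_real (tensor \<phi> x) \<partial>lborel) =
     (\<integral>x. (\<Prod>k\<in>UNIV. exp (- \<i> * of_real (\<xi> $ k * x $ k)) * of_real (\<phi> k (x $ k))) \<partial>lborel)"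
    by (simp only: exp_inner_eq_prod tensor_def of_real_prod prod.distrib)
  also have "\<dots> = tensor_fourier \<phi> \<xi>"
    unfolding tensor_fourier_def fourier1_def
    by (intro integral_lborel_prod test_function_integrable_mult assms continuous_intros)
  finally show ?thesis unfolding fourier_def by simp
qed

lemma fourier1_integrable_mult_iexp:
  assumes "test_function f"
  shows "integrable lborel (\<lambda>s. exp (\<i> * of_real (s * x)) * fourier1 f s)"
proof (rule Bochner_Integration.integrable_bound[OF fourier1_integrable[OF assms]])
  note [measurable] = fourier1_measurable[OF assms]
  show "(\<lambda>s. exp (\<i> * of_real (s * x)) * fourier1 f s) \<in> borel_measurable lborel" by measurable
  show "AE s in lborel. norm (exp (\<i> * of_real (s * x)) * fourier1 f s) \<le> norm ((1 + s\<^sup>2) * cmod (fourier1 f s))"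
    by (auto simp: norm_mult abs_mult intro!: mult_right_le_one_le mult_le_cancel_right1[THEN iffD2])
qed

lemma
  fixes \<phi> :: "'n::finite \<Rightarrow> real \<Rightarrow> real"
  assumes "\<And>k. test_function (\<phi> k)"
  shows tensor_fourier_integrable: "integrable lborel (\<lambda>\<xi>. exp (\<i> * of_real (\<xi> \<bullet> x)) * tensor_fourier \<phi> \<xi>)"
    and tensor_fourier_inversion: "(\<integral>\<xi>. exp (\<i> * of_real (\<xi> \<bullet> x)) * tensor_fourier \<phi> \<xi> \<partial>lborel) =
      of_real ((2 * pi) ^ CARD('n) * tensor \<phi> x)"
proof -
  have eq: "exp (\<i> * of_real (\<xi> \<bullet> x)) * tensor_fourier \<phi> \<xi> =
     (\<Prod>k\<in>UNIV. exp (\<i> * of_real (\<xi> $ k * x $ k)) * fourier1 (\<phi> k) (\<xi> $ k))" for \<xi>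
    by (simp only: exp_inner_eq_prod tensor_fourier_def prod.distrib)
  show "integrable lborel (\<lambda>\<xi>. exp (\<i> * of_real (\<xi> \<bullet> x)) * tensor_fourier \<phi> \<xi>)"
    unfolding eq by (intro integrable_lborel_prod fourier1_integrable_mult_iexp assms)
  have "(\<integral>\<xi>. exp (\<i> * of_real (\<xi> \<bullet> x)) * tensor_fourier \<phi> \<xi> \<partial>lborel) =
     (\<Prod>k\<in>UNIV. \<integral>s. exp (\<i> * of_real (s * x $ k)) * fourier1 (\<phi> k) s \<partial>lborel)"
    unfolding eq by (intro integral_lborel_prod fourier1_integrable_mult_iexp assms)
  also have "\<dots> = (\<Prod>k\<in>UNIV. of_real (2 * pi * \<phi> k (x $ k)))"
    by (simp only: fourier1_inversion assms)
  also have "\<dots> = of_real ((2 * pi) ^ CARD('n) * tensor \<phi> x)"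
    by (simp only: tensor_def of_real_prod[symmetric] prod.distrib prod_constant) (simp add: power_mult_distrib)
  finally show "(\<integral>\<xi>. exp (\<i> * of_real (\<xi> \<bullet> x)) * tensor_fourier \<phi> \<xi> \<partial>lborel) =
      of_real ((2 * pi) ^ CARD('n) * tensor \<phi> x)" .
qed

lemma tensor_fourier_deriv:
  assumes "test_function (\<phi> j)"
  shows "tensor_fourier (\<phi>(j := deriv (\<phi> j))) \<xi> = \<i> * of_real (\<xi> $ j) * tensor_fourier \<phi> \<xi>"
proof -
  have "tensor_fourier (\<phi>(j := deriv (\<phi> j))) \<xi> =
     fourier1 (deriv (\<phi> j)) (\<xi> $ j) * (\<Prod>k\<in>UNIV - {j}. fourier1 (\<phi> k) (\<xi> $ k))"
    unfolding tensor_fourier_def by (subst prod.remove[of _ j]) (auto intro!: prod.cong)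
  moreover have "tensor_fourier \<phi> \<xi> = fourier1 (\<phi> j) (\<xi> $ j) * (\<Prod>k\<in>UNIV - {j}. fourier1 (\<phi> k) (\<xi> $ k))"
    unfolding tensor_fourier_def by (subst prod.remove[of _ j]) auto
  ultimately show ?thesis by (simp add: fourier1_deriv assms)
qed

lemma one_add_sum_le_prod:
  fixes a :: "'a \<Rightarrow> real"
  assumes "finite A" and "\<And>k. k \<in> A \<Longrightarrow> 0 \<le> a k"
  shows "1 + (\<Sum>k\<in>A. a k) \<le> (\<Prod>k\<in>A. 1 + a k)"
  using assms
proof (induction A rule: finite_induct)
  case (insert k A)
  then have "1 + (\<Sum>k\<in>A. a k) \<le> (\<Prod>k\<in>A. 1 + a k)" "0 \<le> (\<Sum>k\<in>A. a k)" "0 \<le> a k"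
    by (auto intro: sum_nonneg)
  then have "a k * 1 \<le> a k * (\<Prod>k\<in>A. 1 + a k)" by (intro mult_left_mono) auto
  with insert show ?case by (simp add: algebra_simps)
qed auto

lemma tensor_fourier_measurable:
  assumes "\<And>k. test_function (\<phi> k)"
  shows "tensor_fourier \<phi> \<in> borel_measurable borel"
  unfolding tensor_fourier_def[abs_def]
  by (intro borel_measurable_prod measurable_compose[OF vec_nth_measurable fourier1_measurable] assms)

text \<open>The weight \<open>2 + |\<xi>|\<^sup>2\<close> is at most twice the product of the \<open>1 + \<xi>\<^sub>k\<^sup>2\<close>, and so is dominated by a
  function whose integral factorises.\<close>
lemma tensor_fourier_second_moment:
  assumes "\<And>k. test_function (\<phi> k)"
  shows "integrable lborel (\<lambda>\<xi>. (2 + (norm \<xi>)\<^sup>2) * cmod (tensor_fourier \<phi> \<xi>))"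
proof (rule Bochner_Integration.integrable_bound)
  show "integrable lborel (\<lambda>\<xi> :: real ^ 'a. 2 * (\<Prod>k\<in>UNIV. (1 + (\<xi> $ k)\<^sup>2) * cmod (fourier1 (\<phi> k) (\<xi> $ k))))"
    by (intro integrable_mult_right integrable_lborel_prod[where h = "\<lambda>k s. (1 + s\<^sup>2) * cmod (fourier1 (\<phi> k) s)"]
        fourier1_integrable assms)
  note [measurable] = tensor_fourier_measurable[OF assms]
  show "(\<lambda>\<xi>. (2 + (norm \<xi>)\<^sup>2) * cmod (tensor_fourier \<phi> \<xi>)) \<in> borel_measurable lborel" by measurable
  have "norm ((2 + (norm \<xi>)\<^sup>2) * cmod (tensor_fourier \<phi> \<xi>))
      \<le> norm (2 * (\<Prod>k\<in>UNIV. (1 + (\<xi> $ k)\<^sup>2) * cmod (fourier1 (\<phi> k) (\<xi> $ k))))" for \<xi>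
  proof -
    have "(norm \<xi>)\<^sup>2 = (\<Sum>k\<in>UNIV. (\<xi> $ k)\<^sup>2)"
      unfolding power2_norm_eq_inner inner_vec_def by (simp add: power2_eq_square)
    moreover have "1 + (\<Sum>k\<in>UNIV. (\<xi> $ k)\<^sup>2) \<le> (\<Prod>k\<in>UNIV. 1 + (\<xi> $ k)\<^sup>2)"
      by (intro one_add_sum_le_prod) auto
    moreover have "0 \<le> (\<Sum>k\<in>UNIV. (\<xi> $ k)\<^sup>2)" by (intro sum_nonneg) auto
    ultimately have "2 + (norm \<xi>)\<^sup>2 \<le> 2 * (\<Prod>k\<in>UNIV. 1 + (\<xi> $ k)\<^sup>2)" by linarith
    then have "(2 + (norm \<xi>)\<^sup>2) * cmod (tensor_fourier \<phi> \<xi>) \<le>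
        2 * (\<Prod>k\<in>UNIV. 1 + (\<xi> $ k)\<^sup>2) * cmod (tensor_fourier \<phi> \<xi>)"
      by (intro mult_right_mono) auto
    also have "\<dots> = 2 * (\<Prod>k\<in>UNIV. (1 + (\<xi> $ k)\<^sup>2) * cmod (fourier1 (\<phi> k) (\<xi> $ k)))"
      by (simp add: prod.distrib tensor_fourier_def prod_norm)
    finally have le: "(2 + (norm \<xi>)\<^sup>2) * cmod (tensor_fourier \<phi> \<xi>) \<le>
        2 * (\<Prod>k\<in>UNIV. (1 + (\<xi> $ k)\<^sup>2) * cmod (fourier1 (\<phi> k) (\<xi> $ k)))" .
    have "norm ((2 + (norm \<xi>)\<^sup>2) * cmod (tensor_fourier \<phi> \<xi>)) = (2 + (norm \<xi>)\<^sup>2) * cmod (tensor_fourier \<phi> \<xi>)"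
      by (simp add: abs_mult)
    also note le
    also note abs_ge_self
    finally show ?thesis by (simp only: real_norm_def)
  qed
  then show "AE \<xi> in lborel. norm ((2 + (norm \<xi>)\<^sup>2) * cmod (tensor_fourier \<phi> \<xi>))
      \<le> norm (2 * (\<Prod>k\<in>UNIV. (1 + (\<xi> $ k)\<^sup>2) * cmod (fourier1 (\<phi> k) (\<xi> $ k))))"
    by simp
qed

section \<open>The generator as an integro-differential operator\<close>

lemma levy_measure_id_measurable: "levy_measure \<nu> \<Longrightarrow> (\<lambda>y. y) \<in> \<nu> \<rightarrow>\<^sub>M borel"
  unfolding levy_measure_def
  using measurable_restrict_space1[OF measurable_ident, of borel "- {0}"]
  by (simp add: id_def cong: measurable_cong_sets)

lemma levy_measure_space: "levy_measure \<nu> \<Longrightarrow> space \<nu> = - {0}"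
  unfolding levy_measure_def by (auto dest: sets_eq_imp_space_eq simp: space_restrict_space)

lemma levy_measure_integrable:
  assumes "levy_measure \<nu>"
  shows "integrable \<nu> (\<lambda>y. min 1 ((norm y)\<^sup>2))"
proof (rule integrableI_bounded)
  note [measurable] = levy_measure_id_measurable[OF assms]
  show "(\<lambda>y. min 1 ((norm y)\<^sup>2)) \<in> borel_measurable \<nu>" by measurable
  show "(\<integral>\<^sup>+ y. ennreal (norm (min 1 ((norm y)\<^sup>2))) \<partial>\<nu>) < \<infinity>"
    using assms by (simp add: levy_measure_def abs_of_nonneg)
qed

text \<open>Needed for Fubini's theorem. The sets on which \<open>min 1 |y|\<^sup>2\<close> is at least \<open>1/(n + 1)\<close> have finite
  measure by Markov's inequality, and they exhaust the space as the origin is excluded.\<close>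
lemma levy_measure_sigma_finite:
  assumes "levy_measure \<nu>"
  shows "sigma_finite_measure \<nu>"
proof
  note [measurable] = levy_measure_id_measurable[OF assms]
  let ?g = "\<lambda>y :: real ^ 'a. min 1 ((norm y)\<^sup>2)"
  let ?A = "\<lambda>n. {y \<in> space \<nu>. 1 / real (Suc n) \<le> ?g y}"
  show "\<exists>A. countable A \<and> A \<subseteq> sets \<nu> \<and> \<Union> A = space \<nu> \<and> (\<forall>a\<in>A. emeasure \<nu> a \<noteq> \<infinity>)"
  proof (intro exI[of _ "range ?A"] conjI ballI)
    show "range ?A \<subseteq> sets \<nu>" by auto
    show "\<Union> (range ?A) = space \<nu>"
    proof safe
      fix y assume y: "y \<in> space \<nu>"
      then have "0 < ?g y" using levy_measure_space[OF assms] by simp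
      then obtain n where "inverse (real (Suc n)) < ?g y" using reals_Archimedean by blast
      with y show "y \<in> \<Union> (range ?A)" by (auto simp: inverse_eq_divide intro!: exI[of _ n])
    qed
    fix a assume "a \<in> range ?A"
    then obtain n where a: "a = ?A n" by auto
    have "emeasure \<nu> (?A n) \<noteq> \<infinity>"
    proof -
      have "a \<in> sets \<nu>" unfolding a by measurable
      have "emeasure \<nu> a = (\<integral>\<^sup>+ y. indicator a y \<partial>\<nu>)" using \<open>a \<in> sets \<nu>\<close> by simp
      also have "\<dots> \<le> (\<integral>\<^sup>+ y. ennreal (real (Suc n)) * ennreal (?g y) \<partial>\<nu>)"
      proof (intro nn_integral_mono)
        fix y
        show "indicator a y \<le> ennreal (real (Suc n)) * ennreal (?g y)"
        proof (cases "y \<in> a")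
          case True
          then have "1 \<le> real (Suc n) * ?g y" unfolding a by (auto simp: field_simps)
          then have "ennreal 1 \<le> ennreal (real (Suc n) * ?g y)" by (rule ennreal_leI)
          with True show ?thesis by (simp add: ennreal_mult del: of_nat_Suc)
        qed simp
      qed
      also have "\<dots> = ennreal (real (Suc n)) * (\<integral>\<^sup>+ y. ennreal (?g y) \<partial>\<nu>)"
        by (intro nn_integral_cmult) measurable
      also have "\<dots> < \<infinity>"
        using assms unfolding levy_measure_def
        by (simp add: ennreal_mult_less_top del: of_nat_Suc)
      finally show ?thesis unfolding a by simp
    qed
    then show "emeasure \<nu> a \<noteq> \<infinity>" unfolding a .
  qed auto
qed

lemma cutoff_eq: "y \<noteq> 0 \<Longrightarrow> cutoff y = (if norm y < 1 then 1 else 0)"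
  by (auto simp: cutoff_def)

text \<open>Small \<open>y\<close> are handled by the second-order Taylor bound for the exponential, large \<open>y\<close> by boundedness.
  The bound is a product of a function of \<open>\<xi>\<close> and a \<open>\<nu>\<close>-integrable function of \<open>y\<close>, as
  domination on the product space requires.\<close>
lemma compensated_exp_bound:
  assumes "y \<noteq> 0"
  shows "cmod (exp (\<i> * of_real (\<xi> \<bullet> y)) - 1 - \<i> * of_real (\<xi> \<bullet> y) * of_real (cutoff y))
    \<le> (2 + (norm \<xi>)\<^sup>2) * min 1 ((norm y)\<^sup>2)"
proof (cases "norm y < 1")
  case True
  have "cmod (exp (\<i> * of_real (\<xi> \<bullet> y)) - 1 - \<i> * of_real (\<xi> \<bullet> y)) \<le> \<bar>\<xi> \<bullet> y\<bar>\<^sup>2 / 2"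
    using iexp_approx1[of "\<xi> \<bullet> y" 1] by (simp add: numeral_2_eq_2 diff_diff_eq)
  also have "\<dots> \<le> (norm \<xi> * norm y)\<^sup>2 / 2"
    by (intro divide_right_mono power_mono Cauchy_Schwarz_ineq2) auto
  also have "\<dots> \<le> (2 + (norm \<xi>)\<^sup>2) * (norm y)\<^sup>2"
  proof -
    have "0 \<le> (norm \<xi>)\<^sup>2 * (norm y)\<^sup>2" "0 \<le> (norm y)\<^sup>2" by auto
    then show ?thesis by (simp add: power_mult_distrib distrib_right)
  qed
  also have "(norm y)\<^sup>2 = min 1 ((norm y)\<^sup>2)"
    using True by (intro min_absorb2[symmetric] power_le_one) auto
  finally show ?thesis using True assms by (simp add: cutoff_eq)
next
  case False
  have "cmod (exp (\<i> * of_real (\<xi> \<bullet> y)) - 1) \<le> 2"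
    by (rule order_trans[OF norm_triangle_ineq4]) simp
  then have "cmod (exp (\<i> * of_real (\<xi> \<bullet> y)) - 1) \<le> 2 + (norm \<xi>)\<^sup>2"
    by (rule order_trans) simp
  moreover have "min 1 ((norm y)\<^sup>2) = 1" using False by (simp add: min_def)
  ultimately show ?thesis using False assms by (simp add: cutoff_eq)
qed

abbreviation tensor_partial :: "('n::finite \<Rightarrow> real \<Rightarrow> real) \<Rightarrow> 'n \<Rightarrow> real ^ 'n \<Rightarrow> real" where
  "tensor_partial \<phi> j \<equiv> tensor (\<phi>(j := deriv (\<phi> j)))"

text \<open>Insert the Levy-Khintchine formula into the Fourier representation of the generator and exchange
  the \<open>\<xi>\<close>- and the \<open>\<nu>\<close>-integral. By Fourier inversion the factor \<open>exp(i \<xi>\<cdot>y)\<close> becomes a shift by \<open>y\<close>, and the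
  factors \<open>i \<xi>\<^sub>j\<close> become partial derivatives. Integrability is part of the conclusion because otherwise
  the Bochner integral could be zero by convention, and a vanishing integral would carry no
  information on \<open>\<nu>\<close>.\<close>
lemma
  fixes P :: "real ^ 'n \<Rightarrow> 'w measure" and \<nu> :: "real ^ 'n \<Rightarrow> (real ^ 'n) measure"
  assumes sym: "has_symbol P X p" and trip: "characteristic_triplet p b (\<lambda>x. 0) \<nu>"
    and \<phi>: "\<And>k. test_function (\<phi> k)"
  shows generator_tensor_integrable: "integrable (\<nu> x) (\<lambda>y. tensor \<phi> (x + y) - tensor \<phi> x
          - cutoff y * (\<Sum>j\<in>UNIV. y $ j * tensor_partial \<phi> j x))" (is "integrable _ ?J")
    and generator_tensor: "generator P X (tensor \<phi>) x = (\<Sum>j\<in>UNIV. b x $ j * tensor_partial \<phi> j x) +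
      (\<integral>y. tensor \<phi> (x + y) - tensor \<phi> x - cutoff y * (\<Sum>j\<in>UNIV. y $ j * tensor_partial \<phi> j x) \<partial>\<nu> x)"
proof -
  have levy: "levy_measure (\<nu> x)"
    and p: "p x \<xi> = \<i> * of_real (b x \<bullet> \<xi>) +
      (\<integral>y. (exp (\<i> * of_real (\<xi> \<bullet> y)) - 1 - \<i> * of_real (\<xi> \<bullet> y) * of_real (cutoff y)) \<partial>\<nu> x)" for \<xi>
    using trip by (auto simp: characteristic_triplet_def levy_khintchine_def)
  note \<nu>id = levy_measure_id_measurable[OF levy]
  interpret \<nu>: sigma_finite_measure "\<nu> x" by (rule levy_measure_sigma_finite[OF levy])
  interpret pair_sigma_finite "\<nu> x" "lborel :: (real ^ 'n) measure" by standard
  have \<phi>': "test_function ((\<phi>(j := deriv (\<phi> j))) k)" for j k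
    using \<phi> by (auto intro: test_function_deriv)
  \<comment> \<open>\<open>D\<close> comes from Fourier inversion and \<open>c\<close> from each of the two normalised transforms; they cancel.\<close>
  define D where "D = (2 * pi) ^ CARD('n)"
  define c where "c = (2 * pi) powr (- (real CARD('n) / 2))"
  have ccD: "c * c * D = 1"
  proof -
    have "c * c = (2 * pi) powr (- real CARD('n))" by (simp add: c_def flip: powr_add)
    also have "\<dots> = inverse D" unfolding D_def powr_minus by (subst powr_realpow) auto
    finally have "c * c = inverse D" .
    moreover have "D \<noteq> 0" by (simp add: D_def)
    ultimately show ?thesis by simp
  qed
  let ?e = "\<lambda>(\<xi> :: real ^ 'n) z. exp (\<i> * of_real (\<xi> \<bullet> z)) :: complex"
  let ?F = "tensor_fourier \<phi>"
  let ?q = "\<lambda>(\<xi> :: real ^ 'n) y. ?e \<xi> y - 1 - \<i> * of_real (\<xi> \<bullet> y) * of_real (cutoff y)"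
  define K where "K y \<xi> = ?e \<xi> x * ?F \<xi> * ?q \<xi> y" for y \<xi>
  have lin: "integrable lborel (\<lambda>\<xi>. ?e \<xi> x * ?F \<xi> * (\<i> * of_real (v \<bullet> \<xi>)))" (is ?int)
    and lin_eq: "(\<integral>\<xi>. ?e \<xi> x * ?F \<xi> * (\<i> * of_real (v \<bullet> \<xi>)) \<partial>lborel) =
      of_real (D * (\<Sum>j\<in>UNIV. v $ j * tensor_partial \<phi> j x))" (is ?eq) for v
  proof -
    have eq: "?e \<xi> x * ?F \<xi> * (\<i> * of_real (v \<bullet> \<xi>)) =
       (\<Sum>j\<in>UNIV. of_real (v $ j) * (?e \<xi> x * tensor_fourier (\<phi>(j := deriv (\<phi> j))) \<xi>))" for \<xi>
    proof -
      have "complex_of_real (v \<bullet> \<xi>) = (\<Sum>j\<in>UNIV. of_real (v $ j) * of_real (\<xi> $ j))"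
        by (simp add: inner_vec_def)
      moreover have "E * F * (\<i> * (\<Sum>j\<in>UNIV. of_real (v $ j) * of_real (\<xi> $ j))) =
         (\<Sum>j\<in>UNIV. of_real (v $ j) * (E * (\<i> * of_real (\<xi> $ j) * F)))" for E F :: complex
        by (simp add: sum_distrib_left mult_ac)
      ultimately show ?thesis by (simp only: tensor_fourier_deriv[of \<phi>, OF \<phi>])
    qed
    have int: "integrable lborel (\<lambda>\<xi>. complex_of_real (v $ j) * (?e \<xi> x * tensor_fourier (\<phi>(j := deriv (\<phi> j))) \<xi>))" for j
      by (intro integrable_mult_right tensor_fourier_integrable \<phi>')
    show ?int unfolding eq by (intro Bochner_Integration.integrable_sum int)
    have "(\<integral>\<xi>. ?e \<xi> x * ?F \<xi> * (\<i> * of_real (v \<bullet> \<xi>)) \<partial>lborel) =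
      (\<Sum>j\<in>UNIV. of_real (v $ j) * (\<integral>\<xi>. ?e \<xi> x * tensor_fourier (\<phi>(j := deriv (\<phi> j))) \<xi> \<partial>lborel))"
      unfolding eq by (subst Bochner_Integration.integral_sum[OF int]) simp
    also have "\<dots> = (\<Sum>j\<in>UNIV. of_real (v $ j) * of_real (D * tensor_partial \<phi> j x))"
      by (simp only: tensor_fourier_inversion[OF \<phi>'] D_def)
    also have "\<dots> = of_real (D * (\<Sum>j\<in>UNIV. v $ j * tensor_partial \<phi> j x))"
      by (simp add: sum_distrib_left mult_ac)
    finally show ?eq .
  qed
  have K_int: "integrable (\<nu> x \<Otimes>\<^sub>M lborel) (case_prod K)"
  proof (rule Bochner_Integration.integrable_bound)
    show "integrable (\<nu> x \<Otimes>\<^sub>M lborel)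
        (\<lambda>(y, \<xi>). min 1 ((norm y)\<^sup>2) * ((2 + (norm \<xi>)\<^sup>2) * cmod (?F \<xi>)))"
      by (intro integrable_product levy_measure_integrable levy tensor_fourier_second_moment \<phi>)
    have [measurable]: "fst \<in> \<nu> x \<Otimes>\<^sub>M (lborel :: (real ^ 'n) measure) \<rightarrow>\<^sub>M borel"
      using measurable_compose[OF measurable_fst[of "\<nu> x" "lborel :: (real ^ 'n) measure"] \<nu>id] by simp
    have [measurable]: "snd \<in> \<nu> x \<Otimes>\<^sub>M (lborel :: (real ^ 'n) measure) \<rightarrow>\<^sub>M borel"
      using measurable_snd[of "\<nu> x" "lborel :: (real ^ 'n) measure"] by simp
    note [measurable] = tensor_fourier_measurable[OF \<phi>]
    have [measurable]: "cutoff \<in> borel_measurable borel" unfolding cutoff_def[abs_def] by measurable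
    show "case_prod K \<in> borel_measurable (\<nu> x \<Otimes>\<^sub>M lborel)"
      unfolding K_def split_beta' by measurable
    show "AE z in \<nu> x \<Otimes>\<^sub>M lborel. norm (case z of (y, \<xi>) \<Rightarrow> K y \<xi>)
        \<le> norm (case z of (y, \<xi>) \<Rightarrow> min 1 ((norm y)\<^sup>2) * ((2 + (norm \<xi>)\<^sup>2) * cmod (?F \<xi>)))"
    proof (rule AE_I2)
      fix z assume z: "z \<in> space (\<nu> x \<Otimes>\<^sub>M (lborel :: (real ^ 'n) measure))"
      obtain y \<xi> where yx: "z = (y, \<xi>)" by force
      with z have "y \<noteq> 0" by (auto simp: space_pair_measure levy_measure_space[OF levy])
      have "norm (K y \<xi>) = cmod (?F \<xi>) * cmod (?q \<xi> y)"
        unfolding K_def by (simp add: norm_mult)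
      also have "\<dots> \<le> cmod (?F \<xi>) * ((2 + (norm \<xi>)\<^sup>2) * min 1 ((norm y)\<^sup>2))"
        by (intro mult_left_mono compensated_exp_bound \<open>y \<noteq> 0\<close>) auto
      also have "\<dots> = min 1 ((norm y)\<^sup>2) * ((2 + (norm \<xi>)\<^sup>2) * cmod (?F \<xi>))"
        by (simp only: mult_ac)
      also note abs_ge_self
      finally show "norm (case z of (y, \<xi>) \<Rightarrow> K y \<xi>)
        \<le> norm (case z of (y, \<xi>) \<Rightarrow> min 1 ((norm y)\<^sup>2) * ((2 + (norm \<xi>)\<^sup>2) * cmod (?F \<xi>)))"
        by (simp only: yx prod.case real_norm_def)
    qed
  qed
  have K_xi: "(\<integral>\<xi>. K y \<xi> \<partial>lborel) = of_real (D * ?J y)" for y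
  proof -
    have eq: "K y \<xi> = ?e \<xi> (x + y) * ?F \<xi> - ?e \<xi> x * ?F \<xi>
        - of_real (cutoff y) * (?e \<xi> x * ?F \<xi> * (\<i> * of_real (y \<bullet> \<xi>)))" for \<xi>
      unfolding K_def by (simp add: inner_add_right distrib_left exp_add algebra_simps inner_commute)
    have "(\<integral>\<xi>. K y \<xi> \<partial>lborel) = (\<integral>\<xi>. ?e \<xi> (x + y) * ?F \<xi> \<partial>lborel) - (\<integral>\<xi>. ?e \<xi> x * ?F \<xi> \<partial>lborel)
       - of_real (cutoff y) * (\<integral>\<xi>. ?e \<xi> x * ?F \<xi> * (\<i> * of_real (y \<bullet> \<xi>)) \<partial>lborel)"
      unfolding eq
      by (subst Bochner_Integration.integral_diff, intro Bochner_Integration.integrable_diff tensor_fourier_integrable \<phi>,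
          intro integrable_mult_right lin,
          subst Bochner_Integration.integral_diff, intro tensor_fourier_integrable \<phi>,
          intro tensor_fourier_integrable \<phi>, subst integral_mult_right_zero, rule refl)
    also have "\<dots> = of_real (D * ?J y)"
      unfolding lin_eq tensor_fourier_inversion[OF \<phi>] D_def[symmetric]
      by (simp add: algebra_simps)
    finally show ?thesis .
  qed
  have "D > 0" by (simp add: D_def)
  have "integrable (\<nu> x) (\<lambda>y. complex_of_real (D * ?J y))"
    using integrable_fst[OF K_int] unfolding K_xi .
  then have "integrable (\<nu> x) (\<lambda>y. D * ?J y)" by (simp only: complex_of_real_integrable_eq)
  then show "integrable (\<nu> x) ?J"
    using \<open>D > 0\<close> by simp
  have K_y: "(\<integral>y. K y \<xi> \<partial>\<nu> x) = ?e \<xi> x * ?F \<xi> * (\<integral>y. ?q \<xi> y \<partial>\<nu> x)" for \<xi>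
    unfolding K_def by (rule integral_mult_right_zero)
  have K_yint: "integrable lborel (\<lambda>\<xi>. \<integral>y. K y \<xi> \<partial>\<nu> x)"
    by (rule integrable_snd[OF K_int])
  have "of_real (generator P X (tensor \<phi>) x) =
    of_real c * (\<integral>\<xi>. ?e \<xi> x * p x \<xi> * (of_real c * ?F \<xi>) \<partial>lborel)"
    using sym tensor_Cc_infinity[of \<phi>, OF \<phi>] unfolding has_symbol_def
    by (simp add: fourier_tensor[of \<phi>, OF \<phi>] c_def)
  also have "(\<integral>\<xi>. ?e \<xi> x * p x \<xi> * (of_real c * ?F \<xi>) \<partial>lborel) =
      (\<integral>\<xi>. of_real c * (?e \<xi> x * ?F \<xi> * (\<i> * of_real (b x \<bullet> \<xi>)) + (\<integral>y. K y \<xi> \<partial>\<nu> x)) \<partial>lborel)"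
    unfolding p K_y by (intro Bochner_Integration.integral_cong) (auto simp: algebra_simps)
  also have "\<dots> = of_real c * ((\<integral>\<xi>. ?e \<xi> x * ?F \<xi> * (\<i> * of_real (b x \<bullet> \<xi>)) \<partial>lborel) +
      (\<integral>\<xi>. \<integral>y. K y \<xi> \<partial>\<nu> x \<partial>lborel))"
    by (simp only: integral_mult_right_zero Bochner_Integration.integral_add[OF lin K_yint])
  also have "(\<integral>\<xi>. \<integral>y. K y \<xi> \<partial>\<nu> x \<partial>lborel) = (\<integral>y. of_real (D * ?J y) \<partial>\<nu> x)"
    unfolding Fubini_integral[OF K_int] K_xi ..
  also have "\<dots> = of_real (D * (\<integral>y. ?J y \<partial>\<nu> x))"
    by (simp only: integral_complex_of_real integral_mult_right_zero)
  also have "of_real c * (of_real c * ((\<integral>\<xi>. ?e \<xi> x * ?F \<xi> * (\<i> * of_real (b x \<bullet> \<xi>)) \<partial>lborel) +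
        complex_of_real (D * (\<integral>y. ?J y \<partial>\<nu> x)))) =
      of_real (c * c * D * ((\<Sum>j\<in>UNIV. b x $ j * tensor_partial \<phi> j x) + (\<integral>y. ?J y \<partial>\<nu> x)))"
    unfolding lin_eq by (simp only: of_real_mult of_real_add) (simp add: algebra_simps)
  finally show "generator P X (tensor \<phi>) x = (\<Sum>j\<in>UNIV. b x $ j * tensor_partial \<phi> j x) + (\<integral>y. ?J y \<partial>\<nu> x)"
    unfolding ccD by (simp only: mult_1 of_real_eq_iff)
qed

section \<open>Orthant dependence and simultaneous jumps in opposite directions\<close>

lemma generator_tendsto:
  assumes "rich_feller_process P X" and "f \<in> Cc_infinity"
  shows "((\<lambda>t. (transition_semigroup P X t f x - f x) / t) \<longlongrightarrow> generator P X f x) (at_right 0)"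
proof -
  from assms obtain g where g: "has_generator_value P X f g"
    unfolding rich_feller_process_def generator_domain_def by blast
  then have "generator P X f = g" by (rule generator_eqI)
  with g show ?thesis
    unfolding has_generator_value_def by (auto intro: tendsto_uniform_limitI)
qed

text \<open>The event on the left is the difference of the events \<open>Y\<^sub>i > t\<^sub>i\<close> and \<open>\<forall>k. Y\<^sub>k > t\<^sub>k\<close>, and orthant
  dependence bounds the probability of the latter from below by a product. Weierstrass' product inequality
  turns this product into the sum on the right. It is the product of two small quantities that makes
  the estimate useful.\<close>
lemma (in prob_space) prob_gt_not_all_gt_le:
  fixes Y :: "'a \<Rightarrow> real ^ 'n"
  assumes Y [measurable]: "Y \<in> borel_measurable M" and "PUOD M Y"
  shows "prob {\<omega> \<in> space M. Y \<omega> $ i > t $ i \<and> \<not> (\<forall>k. Y \<omega> $ k > t $ k)} \<le>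
    prob {\<omega> \<in> space M. Y \<omega> $ i > t $ i} * (\<Sum>k\<in>UNIV - {i}. prob {\<omega> \<in> space M. Y \<omega> $ k \<le> t $ k})"
proof -
  define m where "m k = prob {\<omega> \<in> space M. Y \<omega> $ k > t $ k}" for k
  have compl: "prob {\<omega> \<in> space M. Y \<omega> $ k \<le> t $ k} = 1 - m k" for k
    unfolding m_def by (subst prob_neg[symmetric]) (auto simp: not_less)
  have "prob {\<omega> \<in> space M. Y \<omega> $ i > t $ i} = prob {\<omega> \<in> space M. \<forall>k. Y \<omega> $ k > t $ k}
      + prob {\<omega> \<in> space M. Y \<omega> $ i > t $ i \<and> \<not> (\<forall>k. Y \<omega> $ k > t $ k)}"
    by (subst finite_measure_Union[symmetric]) (auto intro!: arg_cong[where f = prob])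
  moreover have "(\<Prod>k\<in>UNIV. m k) \<le> prob {\<omega> \<in> space M. \<forall>k. Y \<omega> $ k > t $ k}"
    using assms(2) by (simp add: PUOD_def m_def)
  moreover have "m i * (1 - (\<Sum>k\<in>UNIV - {i}. 1 - m k)) \<le> (\<Prod>k\<in>UNIV. m k)"
  proof -
    have "1 - (\<Sum>k\<in>UNIV - {i}. 1 - m k) \<le> (\<Prod>k\<in>UNIV - {i}. 1 - (1 - m k))"
      by (intro Weierstrass_prod_ineq) (auto simp: m_def)
    then have "m i * (1 - (\<Sum>k\<in>UNIV - {i}. 1 - m k)) \<le> m i * (\<Prod>k\<in>UNIV - {i}. m k)"
      by (intro mult_left_mono) (auto simp: m_def)
    also have "\<dots> = (\<Prod>k\<in>UNIV. m k)"
      by (subst prod.remove[of UNIV i]) auto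
    finally show ?thesis .
  qed
  ultimately show ?thesis
    unfolding compl m_def[symmetric] by (simp add: right_diff_distrib)
qed

definition exit_prob ::
    "(real ^ 'n \<Rightarrow> 'w measure) \<Rightarrow> (real \<Rightarrow> 'w \<Rightarrow> real ^ 'n) \<Rightarrow> real ^ 'n \<Rightarrow> real \<Rightarrow> real \<Rightarrow> real"
  where "exit_prob P X x r t = measure (P x) {\<omega> \<in> space (P x). \<exists>k. \<bar>X t \<omega> $ k - x $ k\<bar> \<ge> r}"

lemma rich_feller_process_prob_space: "rich_feller_process P X \<Longrightarrow> prob_space (P x)"
  by (simp add: rich_feller_process_def feller_process_def markov_process_def)

lemma rich_feller_process_measurable:
  "rich_feller_process P X \<Longrightarrow> t \<ge> 0 \<Longrightarrow> X t \<in> P x \<rightarrow>\<^sub>M borel"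
  by (simp add: rich_feller_process_def feller_process_def markov_process_def)

lemma tensor_measurable:
  assumes "\<And>k. test_function (\<phi> k)"
  shows "tensor \<phi> \<in> borel_measurable borel"
  unfolding tensor_def[abs_def]
  by (intro borel_measurable_prod measurable_compose[OF vec_nth_measurable test_function_measurable] assms)

lemma tensor_bump_bounds: "0 \<le> tensor (\<lambda>k. bump (l k) (u k)) y" "tensor (\<lambda>k. bump (l k) (u k)) y \<le> 1"
  unfolding tensor_def by (auto intro!: prod_nonneg prod_le_1 bump_nonneg bump_le_1)

lemma tensor_bump_pos_iff:
  "0 < tensor (\<lambda>k. bump (l k) (u k)) y \<longleftrightarrow> (\<forall>k. l k < y $ k \<and> y $ k < u k)"
proof -
  have "tensor (\<lambda>k. bump (l k) (u k)) y \<noteq> 0 \<longleftrightarrow> (\<forall>k. l k < y $ k \<and> y $ k < u k)"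
    by (simp add: tensor_def bump_eq_0_iff)
  then show ?thesis using tensor_bump_bounds(1)[of l u y] by (simp add: less_le)
qed

text \<open>A bump \<open>g\<close> centred at \<open>x\<close> takes its maximum at \<open>x\<close> and vanishes outside the box of radius \<open>r\<close>, so that
  \<open>g(x) - T\<^sub>t g(x)\<close> is at least \<open>g(x)\<close> times the exit probability. It is of order \<open>t\<close> since \<open>g\<close> lies
  in the domain of the generator.\<close>
lemma eventually_exit_prob_le:
  fixes P :: "real ^ 'n \<Rightarrow> 'w measure"
  assumes rich: "rich_feller_process P X" and "r > 0"
  shows "\<exists>K. \<forall>\<^sub>F t in at_right 0. exit_prob P X x r t \<le> K * t"
proof -
  interpret prob_space "P x" by (rule rich_feller_process_prob_space[OF rich])
  define g where "g = tensor (\<lambda>k. bump (x $ k - r) (x $ k + r))"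
  have test: "test_function (bump (x $ k - r) (x $ k + r))" for k by (rule test_function_bump)
  have gC: "g \<in> Cc_infinity" unfolding g_def by (intro tensor_Cc_infinity test)
  have [measurable]: "g \<in> borel_measurable borel" unfolding g_def by (intro tensor_measurable test)
  have g_pos: "g x > 0" using \<open>r > 0\<close> by (simp add: g_def tensor_bump_pos_iff)
  have g_nonneg: "0 \<le> g y" for y unfolding g_def by (rule tensor_bump_bounds)
  have g_le: "g y \<le> g x" for y
    unfolding g_def tensor_def using \<open>r > 0\<close> by (intro prod_mono conjI bump_nonneg bump_le_centre)
  have g_0: "g y = 0" if "\<exists>k. \<bar>y $ k - x $ k\<bar> \<ge> r" for y
  proof -
    from that obtain k where "\<bar>y $ k - x $ k\<bar> \<ge> r" by blast
    then have "\<not> (x $ k - r < y $ k \<and> y $ k < x $ k + r)" by linarith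
    then have "\<not> 0 < g y" unfolding g_def tensor_bump_pos_iff by blast
    with g_nonneg[of y] show ?thesis by simp
  qed
  have main: "g x * exit_prob P X x r t \<le> g x - transition_semigroup P X t g x" if "t \<ge> 0" for t
  proof -
    have [measurable]: "X t \<in> P x \<rightarrow>\<^sub>M borel" by (rule rich_feller_process_measurable[OF rich that])
    let ?E = "{\<omega> \<in> space (P x). \<exists>k. \<bar>X t \<omega> $ k - x $ k\<bar> \<ge> r}"
    have E: "?E \<in> events" by measurable
    have int_E: "integrable (P x) (indicat_real ?E)"
      using E by (intro integrable_real_indicator) (auto simp: less_top[symmetric])
    have "transition_semigroup P X t g x = (\<integral>\<omega>. g (X t \<omega>) \<partial>P x)" by (simp add: transition_semigroup_def)
    also have "\<dots> \<le> (\<integral>\<omega>. g x - g x * indicator ?E \<omega> \<partial>P x)"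
    proof (rule integral_mono)
      show "integrable (P x) (\<lambda>\<omega>. g (X t \<omega>))"
        by (rule integrable_const_bound[where B = "g x"]) (use g_nonneg g_le in auto)
      show "integrable (P x) (\<lambda>\<omega>. g x - g x * indicator ?E \<omega>)"
        by (intro Bochner_Integration.integrable_diff integrable_mult_right int_E) auto
      show "g (X t \<omega>) \<le> g x - g x * indicator ?E \<omega>" if "\<omega> \<in> space (P x)" for \<omega>
        using that g_le g_0[of "X t \<omega>"] by (auto simp: indicator_def)
    qed
    also have "\<dots> = g x - g x * exit_prob P X x r t"
      using E int_E by (subst Bochner_Integration.integral_diff) (auto simp: exit_prob_def prob_space)
    finally show ?thesis by simp
  qed
  let ?q = "\<lambda>t. (transition_semigroup P X t g x - g x) / t"
  let ?A = "generator P X g x"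
  have "\<forall>\<^sub>F t in at_right 0. ?q t > ?A - 1"
    using generator_tendsto[OF rich gC] by (rule order_tendstoD) simp
  moreover have "\<forall>\<^sub>F t :: real in at_right 0. t > 0" by (simp add: eventually_at_right_less)
  ultimately have "\<forall>\<^sub>F t in at_right 0. exit_prob P X x r t \<le> (1 - ?A) / g x * t"
  proof eventually_elim
    case (elim t)
    then have "g x - transition_semigroup P X t g x \<le> (1 - ?A) * t"
      by (simp add: field_simps)
    with main[of t] elim have "g x * exit_prob P X x r t \<le> (1 - ?A) * t" by linarith
    then show ?case using g_pos by (simp add: field_simps)
  qed
  then show ?thesis by blast
qed

text \<open>Any one coordinate at which a factor and its derivative vanish suffices: each partial derivative
  contains one of the two.\<close>
lemma tensor_partial_eq_0:
  assumes "\<phi> i (x $ i) = 0" "deriv (\<phi> i) (x $ i) = 0"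
  shows "tensor_partial \<phi> j x = 0"
  using assms by (auto simp: tensor_def intro!: bexI[of _ i])

text \<open>The bump is positive only if coordinate \<open>i\<close> has moved up and coordinate \<open>j\<close> down by at least \<open>r\<close>. Under
  orthant dependence this has probability of order \<open>t\<^sup>2\<close>, so the difference quotients defining the
  generator at \<open>x\<close> have a limit that is at most \<open>0\<close>.\<close>
lemma PUOD_generator_bump_nonpos:
  fixes P :: "real ^ 'n \<Rightarrow> 'w measure"
  assumes rich: "rich_feller_process P X"
    and puod: "\<And>t. t \<ge> 0 \<Longrightarrow> PUOD (P x) (X t)"
    and r: "r > 0" "x $ i + r \<le> l i" "u j \<le> x $ j - r"
  shows "generator P X (tensor (\<lambda>k. bump (l k) (u k))) x \<le> 0"
proof -
  interpret prob_space "P x" by (rule rich_feller_process_prob_space[OF rich])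
  define f where "f = tensor (\<lambda>k. bump (l k) (u k))"
  have fC: "f \<in> Cc_infinity" unfolding f_def by (intro tensor_Cc_infinity test_function_bump)
  have [measurable]: "f \<in> borel_measurable borel"
    unfolding f_def by (intro tensor_measurable test_function_bump)
  have f_bounds: "0 \<le> f y" "f y \<le> 1" for y unfolding f_def by (rule tensor_bump_bounds)+
  have "\<not> 0 < f x" using r unfolding f_def tensor_bump_pos_iff by (auto intro!: exI[of _ i])
  with f_bounds[of x] have fx: "f x = 0" by simp
  let ?ex = "exit_prob P X x r"
  have sg: "transition_semigroup P X t f x \<le> real CARD('n) * (?ex t)\<^sup>2" if "t \<ge> 0" for t
  proof -
    have [measurable]: "X t \<in> P x \<rightarrow>\<^sub>M borel" by (rule rich_feller_process_measurable[OF rich that])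
    have ex: "prob {\<omega> \<in> space (P x). Q \<omega>} \<le> ?ex t"
      if "\<And>\<omega>. Q \<omega> \<Longrightarrow> \<exists>k. \<bar>X t \<omega> $ k - x $ k\<bar> \<ge> r" for Q
      unfolding exit_prob_def by (rule finite_measure_mono) (use that in auto)
    \<comment> \<open>The level vector asks for an upward move of coordinate \<open>i\<close> and for no large downward move of the others.\<close>
    define s :: "real ^ 'n" where "s = (\<chi> k. if k = i then x $ i + r else x $ k - r)"
    let ?E = "{\<omega> \<in> space (P x). X t \<omega> $ i > s $ i \<and> \<not> (\<forall>k. X t \<omega> $ k > s $ k)}"
    have E: "?E \<in> events" by measurable
    have "f (X t \<omega>) \<le> indicator ?E \<omega>" if "\<omega> \<in> space (P x)" for \<omega>
    proof (cases "0 < f (X t \<omega>)")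
      case True
      then have *: "l k < X t \<omega> $ k" "X t \<omega> $ k < u k" for k
        unfolding f_def tensor_bump_pos_iff by auto
      have "s $ i < X t \<omega> $ i" using *(1)[of i] r by (simp add: s_def)
      moreover have "\<not> s $ j < X t \<omega> $ j" using *(1)[of i] *(2)[of j] r by (auto simp: s_def)
      ultimately have "\<omega> \<in> ?E" using that by blast
      then show ?thesis using f_bounds(2) by simp
    qed (use f_bounds in \<open>auto simp: indicator_def not_less intro: order_trans\<close>)
    then have "transition_semigroup P X t f x \<le> (\<integral>\<omega>. indicator ?E \<omega> \<partial>P x)"
      unfolding transition_semigroup_def using f_bounds E
      by (intro integral_mono integrable_const_bound[where B = 1]) auto
    also have "\<dots> = prob ?E" using E by simp
    also have "\<dots> \<le> prob {\<omega> \<in> space (P x). X t \<omega> $ i > s $ i} *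
        (\<Sum>k\<in>UNIV - {i}. prob {\<omega> \<in> space (P x). X t \<omega> $ k \<le> s $ k})"
      by (intro prob_gt_not_all_gt_le puod that) measurable
    also have "\<dots> \<le> ?ex t * (\<Sum>k\<in>(UNIV :: 'n set). ?ex t)"
    proof (intro mult_mono)
      show "prob {\<omega> \<in> space (P x). X t \<omega> $ i > s $ i} \<le> ?ex t"
        by (rule ex) (auto simp: s_def intro!: exI[of _ i])
      have "prob {\<omega> \<in> space (P x). X t \<omega> $ k \<le> s $ k} \<le> ?ex t" if "k \<in> UNIV - {i}" for k
        by (rule ex) (use that in \<open>auto simp: s_def intro!: exI[of _ k]\<close>)
      then have "(\<Sum>k\<in>UNIV - {i}. prob {\<omega> \<in> space (P x). X t \<omega> $ k \<le> s $ k}) \<le> (\<Sum>k\<in>UNIV - {i}. ?ex t)"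
        by (rule sum_mono)
      also have "\<dots> \<le> (\<Sum>k\<in>(UNIV :: 'n set). ?ex t)"
        by (rule sum_mono2) (auto simp: exit_prob_def)
      finally show "(\<Sum>k\<in>UNIV - {i}. prob {\<omega> \<in> space (P x). X t \<omega> $ k \<le> s $ k}) \<le> (\<Sum>k\<in>(UNIV :: 'n set). ?ex t)" .
    qed (auto simp: exit_prob_def intro!: sum_nonneg)
    finally show ?thesis by (simp add: power2_eq_square mult_ac)
  qed
  obtain K where K: "\<forall>\<^sub>F t in at_right 0. ?ex t \<le> K * t"
    using eventually_exit_prob_le[OF rich \<open>r > 0\<close>] by blast
  have pos: "\<forall>\<^sub>F t :: real in at_right 0. t > 0" by (simp add: eventually_at_right_less)
  have "\<forall>\<^sub>F t in at_right 0. (transition_semigroup P X t f x - f x) / t \<le> real CARD('n) * K\<^sup>2 * t"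
    using K pos
  proof eventually_elim
    case (elim t)
    have "transition_semigroup P X t f x \<le> real CARD('n) * (?ex t)\<^sup>2" using sg elim by simp
    also have "\<dots> \<le> real CARD('n) * (K * t)\<^sup>2"
      using elim by (intro mult_left_mono power_mono) (auto simp: exit_prob_def)
    finally show ?case using elim by (simp add: fx field_simps power2_eq_square)
  qed
  moreover have "((\<lambda>t. real CARD('n) * K\<^sup>2 * t) \<longlongrightarrow> real CARD('n) * K\<^sup>2 * 0) (at_right 0)"
    by (intro tendsto_intros)
  ultimately have "generator P X f x \<le> real CARD('n) * K\<^sup>2 * 0"
    using generator_tendsto[OF rich fC] by (intro tendsto_le[OF trivial_limit_at_right_real])
  then show ?thesis by (simp add: f_def)
qed

text \<open>At \<open>x\<close> the bump on the translated box and its gradient vanish, because \<open>x\<^sub>i\<close> lies outside the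
  interval of coordinate \<open>i\<close>. So drift and compensator drop out of the generator, and only the jump
  integral of a nonnegative function remains.\<close>
lemma levy_measure_mixed_box_null:
  fixes P :: "real ^ 'n \<Rightarrow> 'w measure"
  assumes rich: "rich_feller_process P X" and sym: "has_symbol P X p"
    and trip: "characteristic_triplet p b (\<lambda>x. 0) \<nu>"
    and puod: "\<And>t. t \<ge> 0 \<Longrightarrow> PUOD (P x) (X t)"
    and r: "r > 0" "r \<le> l i" "u j \<le> - r"
  shows "{y \<in> space (\<nu> x). \<forall>k. l k < y $ k \<and> y $ k < u k} \<in> null_sets (\<nu> x)"
proof -
  have levy: "levy_measure (\<nu> x)" using trip by (auto simp: characteristic_triplet_def)
  note [measurable] = levy_measure_id_measurable[OF levy]
  define \<phi> where "\<phi> = (\<lambda>k. bump (x $ k + l k) (x $ k + u k))"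
  have test: "test_function (\<phi> k)" for k unfolding \<phi>_def by (rule test_function_bump)
  have 0: "\<phi> i (x $ i) = 0" "deriv (\<phi> i) (x $ i) = 0"
    using r by (auto simp: \<phi>_def bump_eq_0_iff intro!: deriv_bump_outside)
  have partial: "tensor_partial \<phi> k x = 0" for k by (rule tensor_partial_eq_0) (rule 0)+
  have fx: "tensor \<phi> x = 0" using 0(1) by (auto simp: tensor_def)
  have int: "integrable (\<nu> x) (\<lambda>y. tensor \<phi> (x + y))"
    using generator_tensor_integrable[OF sym trip, where \<phi> = \<phi> and x = x, OF test] by (simp only: partial fx) simp
  have "generator P X (tensor \<phi>) x = (\<integral>y. tensor \<phi> (x + y) \<partial>\<nu> x)"
    using generator_tensor[OF sym trip, where \<phi> = \<phi> and x = x, OF test] by (simp only: partial fx) simp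
  moreover have "generator P X (tensor \<phi>) x \<le> 0"
    unfolding \<phi>_def using r by (intro PUOD_generator_bump_nonpos[OF rich puod, where r = r and i = i and j = j]) auto
  moreover have nonneg: "0 \<le> tensor \<phi> (x + y)" for y unfolding \<phi>_def by (rule tensor_bump_bounds)
  ultimately have "(\<integral>y. tensor \<phi> (x + y) \<partial>\<nu> x) = 0"
    by (intro antisym integral_nonneg) auto
  then have "AE y in \<nu> x. tensor \<phi> (x + y) = 0"
    using integral_nonneg_eq_0_iff_AE[OF int] nonneg by simp
  moreover have "tensor \<phi> (x + y) = 0 \<longleftrightarrow> \<not> (\<forall>k. l k < y $ k \<and> y $ k < u k)" for y
    by (auto simp: \<phi>_def tensor_def bump_eq_0_iff)
  ultimately have "AE y in \<nu> x. \<not> (\<forall>k. l k < y $ k \<and> y $ k < u k)" by simp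
  then show ?thesis by (subst (asm) AE_iff_null) auto
qed

text \<open>For \<open>i = j\<close> the box is empty, which allows the union to range over all pairs.\<close>
lemma compl_orthants_subset_boxes:
  "- (pos_orthant \<union> neg_orthant) \<subseteq> (\<Union>i. \<Union>j. \<Union>n. {y :: real ^ 'n. \<forall>k.
     (if k = i then 1 / real (Suc n) else - real (Suc n)) < y $ k \<and>
     y $ k < (if k = j then - 1 / real (Suc n) else real (Suc n))})"
proof
  fix y :: "real ^ 'n"
  assume "y \<in> - (pos_orthant \<union> neg_orthant)"
  then obtain i j where ij: "0 < y $ i" "y $ j < 0"
    by (auto simp: pos_orthant_def neg_orthant_def not_le)
  have "\<forall>\<^sub>F n in sequentially. 1 / real (Suc n) < y $ i"
    by (rule order_tendstoD[OF lim_1_over_n[THEN LIMSEQ_Suc]]) (rule ij)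
  moreover have "\<forall>\<^sub>F n in sequentially. 1 / real (Suc n) < - y $ j"
    by (rule order_tendstoD[OF lim_1_over_n[THEN LIMSEQ_Suc]]) (use ij in simp)
  moreover have "\<forall>\<^sub>F n in sequentially. norm y < real (Suc n)"
    using filterlim_real_sequentially[THEN filterlim_compose, OF filterlim_Suc]
    by (auto simp: filterlim_at_top_dense)
  ultimately have "\<forall>\<^sub>F n in sequentially. 1 / real (Suc n) < y $ i \<and> 1 / real (Suc n) < - y $ j \<and> norm y < real (Suc n)"
    by eventually_elim auto
  then obtain n where n: "1 / real (Suc n) < y $ i" "1 / real (Suc n) < - y $ j" "norm y < real (Suc n)"
    by (auto simp: eventually_sequentially)
  have "\<bar>y $ k\<bar> < real (Suc n)" for k using component_le_norm_cart[of y k] n by linarith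
  then have b: "- real (Suc n) < y $ k" "y $ k < real (Suc n)" for k
    by (simp_all only: abs_less_iff) (metis minus_less_iff)
  have "(if k = i then 1 / real (Suc n) else - real (Suc n)) < y $ k \<and>
     y $ k < (if k = j then - 1 / real (Suc n) else real (Suc n))" for k
    using n b[of k] by (auto simp del: of_nat_Suc)
  then show "y \<in> (\<Union>i. \<Union>j. \<Union>n. {y. \<forall>k.
     (if k = i then 1 / real (Suc n) else - real (Suc n)) < y $ k \<and>
     y $ k < (if k = j then - 1 / real (Suc n) else real (Suc n))})" by blast
qed

theorem theorem3p3:
  fixes P :: "real ^ 'n \<Rightarrow> 'w measure"
    and X :: "real \<Rightarrow> 'w \<Rightarrow> real ^ 'n"
    and p :: "real ^ 'n \<Rightarrow> real ^ 'n \<Rightarrow> complex"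
    and b :: "real ^ 'n \<Rightarrow> real ^ 'n"
    and \<nu> :: "real ^ 'n \<Rightarrow> (real ^ 'n) measure"
  assumes "rich_feller_process P X"
    and "has_symbol P X p"
    and "characteristic_triplet p b (\<lambda>x. 0) \<nu>"
    and "\<And>x t. t \<ge> 0 \<Longrightarrow> PUOD (P x) (X t)"
  shows "\<forall>x. emeasure (\<nu> x) (- (pos_orthant \<union> neg_orthant)) = 0"
proof
  fix x
  have levy: "levy_measure (\<nu> x)" using assms(3) by (auto simp: characteristic_triplet_def)
  define B where "B i j n = {y \<in> space (\<nu> x). \<forall>k.
     (if k = i then 1 / real (Suc n) else - real (Suc n)) < y $ k \<and>
     y $ k < (if k = j then - 1 / real (Suc n) else real (Suc n))}" for i j n
  have "B i j n \<in> null_sets (\<nu> x)" for i j n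
    unfolding B_def
    by (rule levy_measure_mixed_box_null[OF assms(1,2,3,4), where r = "1 / real (Suc n)" and i = i and j = j])
       (auto simp del: of_nat_Suc)
  then have "(\<Union>i. \<Union>j. \<Union>n. B i j n) \<in> null_sets (\<nu> x)"
    by (intro null_sets_UN') (auto intro: countable_finite)
  moreover have "- (pos_orthant \<union> neg_orthant) \<subseteq> (\<Union>i. \<Union>j. \<Union>n. B i j n)"
  proof -
    have "- (pos_orthant \<union> neg_orthant) \<subseteq> space (\<nu> x)"
      using sets.sets_into_space[OF orthants_compl_measurable[OF levy]] .
    with compl_orthants_subset_boxes show ?thesis
      unfolding B_def by (intro subsetI) (drule (1) subsetD, drule (1) subsetD, simp)
  qed
  ultimately have "- (pos_orthant \<union> neg_orthant) \<in> null_sets (\<nu> x)"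
    by (intro null_sets_subset[OF _ orthants_compl_measurable[OF levy]])
  then show "emeasure (\<nu> x) (- (pos_orthant \<union> neg_orthant)) = 0" by (rule null_setsD1)
qed

end
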